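(* Let $q(z)\in\mathbb{C}[[z]]$ with $q(0)=1$ and let $h(z)=q(-z)q(z)^{-1}$. For $n\in\mathbb{N}$, set $$E_n=\mathrm{span}\{u^{(1)}(m_1)\cdots u^{(r)}(m_r)\mathbf{1}\mid 0\le r\le n,\ u^{(i)}\in U,\ m_i\in\mathbb{Z}\}\subset V_{\mathcal{A}(h)},$$ where $U$ is the vector space with basis $\{e,f,\psi\}$. Then the $E_n$ for $n\ge0$ form an ascending filtration of $V_{\mathcal{A}(h)}$, and for $n\in\mathbb{N}$, $E_n$ has a basis consisting of the vectors $$e(-m_1)\cdots e(-m_r)f(-n_1)\cdots f(-n_s)\psi(-k_1)\cdots\psi(-k_l)\mathbf{1},$$ where $r,s,l\ge0$ with $r+s+l\le n$, and $m_i,n_j,k_t$ are positive integers with $m_1\ge\cdots\ge m_r\ge1$, $n_1\ge\cdots\ge n_s\ge1$, $k_1\ge\cdots\ge k_l\ge1$.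
   Context: All vector spaces are over $\mathbb{C}$; $\mathbb{N}=\{0,1,2,\dots\}$; $\delta(x)=\sum_{n\in\mathbb{Z}}x^n$. For $h(z)\in\mathbb{C}[[z]]$ with $h(z)h(-z)=1$, $\mathcal{A}(h)$ is the (topological) associative unital algebra with generators $e_n,f_n,\psi_n$ ($n\in\mathbb{Z}$) and relations $e(z)e(w)=h(w-z)e(w)e(z)$, $f(z)f(w)=h(z-w)f(w)f(z)$, $\psi(z)e(w)=h(w-z)e(w)\psi(z)$, $\psi(z)f(w)=h(z-w)f(w)\psi(z)$, $[e(z),f(w)]=z^{-1}\delta(w/z)\psi(z)$, $[\psi(z),\psi(w)]=0$, where $a(x)=\sum_{n\in\mathbb{Z}}a_nx^{-n-1}$ for $a=e,f,\psi$, and $h(z-w),h(w-z)\in\mathbb{C}[[z,w]]$. We also write $a(n)$ for $a_n$, extended linearly to $a\in U$. $V_{\mathcal{A}(h)}$: Let $\mathfrak{T}=T(U\otimes\mathbb{C}[t,t^{-1}])$ be the tensor algebra, $\mathbb{Z}$-graded by $\deg(u\otimes t^n)=-n$, with $u(n)$ denoting $u\otimes t^n$. Let $d$ be the derivation of $\mathfrak{T}$ with $d(u\otimes t^n)=-n(u\otimes t^{n-1})$. Put $\mathfrak{T}_-=\sum_{n\ge1}\mathfrak{T}_{-n}$ (negative-degree part), $J=\mathfrak{T}\,\mathbb{C}[d]\mathfrak{T}_-$ (a left ideal), $V_{\mathfrak{T}}=\mathfrak{T}/J$, a left $\mathfrak{T}$-module on which for each $w$, $u(n)w=0$ for $n$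 large. $V_{\mathcal{A}(h)}$ is the quotient of $V_{\mathfrak{T}}$ by the submodule corresponding to the defining relations of $\mathcal{A}(h)$ (generated by all coefficients of the relations applied to all vectors; all sums are finite on each vector), and $\mathbf{1}$ is the image of $1$. *)

theory Defs
  imports
    "HOL-Library.Poly_Mapping"
    "HOL-Computational_Algebra.Formal_Power_Series"
    "Jordan_Normal_Form.VS_Connect"
begin

datatype gen = gen_e | gen_f | gen_psi

type_synonym U = "gen \<Rightarrow>\<^sub>0 complex"

abbreviation U_basis :: "gen \<Rightarrow> U" where
  "U_basis g \<equiv> Poly_Mapping.single g 1"

text \<open>
  \<open>U \<otimes> \<complex>[t,t\<^sup>-\<^sup>1]\<close> has the basis \<open>g \<otimes> t\<^sup>n\<close>, so its tensor algebra has as basis the words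
  in the letters \<open>(g, n)\<close>, multiplied by concatenation.  The wrapper type makes words a
  (non-commutative) additive monoid, so that polynomial mappings on words carry the
  convolution product, which is the multiplication of the tensor algebra.
\<close>

datatype word = Word (letters: "(gen \<times> int) list")

instantiation word :: monoid_add
begin

definition zero_word :: word where "zero_word = Word []"
definition plus_word :: "word \<Rightarrow> word \<Rightarrow> word" where
  "plus_word v w = Word (letters v @ letters w)"
instance
  by standard (auto simp: zero_word_def plus_word_def)
end

type_synonym tens = "word \<Rightarrow>\<^sub>0 complex"

definition tscale :: "complex \<Rightarrow> tens \<Rightarrow> tens" where
  "tscale c x = Poly_Mapping.map ((*) c) x"

lemma lookup_tscale [simp]: "Poly_Mapping.lookup (tscale c x) w = c * Poly_Mapping.lookup x w"
  by (auto simp: tscale_def Poly_Mapping.map.rep_eq when_def)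

lemma tscale_conv_mult: "tscale c x = Poly_Mapping.single 0 c * x"
  by (simp add: tscale_def mult_map_scale_conv_mult)

interpretation T: vector_space tscale
  by standard (rule poly_mapping_eqI; simp add: lookup_add algebra_simps)+

lemma tscale_mult_left: "tscale c x * y = tscale c (x * y)"
  by (simp add: tscale_conv_mult mult.assoc)

definition tmode :: "U \<Rightarrow> int \<Rightarrow> tens" where
  "tmode u n = (\<Sum>g\<in>{gen_e, gen_f, gen_psi}. Poly_Mapping.single (Word [(g, n)]) (Poly_Mapping.lookup u g))"

lemma tmode_U_basis: "tmode (U_basis g) n = Poly_Mapping.single (Word [(g, n)]) 1"
  by (cases g) (simp_all add: tmode_def lookup_single)

definition word_deg :: "word \<Rightarrow> int" where
  "word_deg w = (\<Sum>(g, n)\<leftarrow>letters w. - n)"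

definition tens_deg :: "int \<Rightarrow> tens set" where
  "tens_deg m = {x. \<forall>w\<in>Poly_Mapping.keys x. word_deg w = m}"

definition tens_neg :: "tens set" where
  "tens_neg = T.span (\<Union>n\<in>{1..}. tens_deg (- n))"

text \<open>
  \<open>d\<close> is the derivation with \<open>d(u \<otimes> t\<^sup>n) = -n (u \<otimes> t\<^sup>n\<^sup>-\<^sup>1)\<close>; the lemmas \<open>tderiv_mult\<close> and
  \<open>tderiv_tmode\<close> below confirm these properties.
\<close>

primrec deriv_letters :: "(gen \<times> int) list \<Rightarrow> tens" where
  "deriv_letters [] = 0"
| "deriv_letters (x # xs) =
     Poly_Mapping.single (Word [(fst x, snd x - 1)]) (- of_int (snd x)) * Poly_Mapping.single (Word xs) 1
     + Poly_Mapping.single (Word [x]) 1 * deriv_letters xs"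

definition tderiv :: "tens \<Rightarrow> tens" where
  "tderiv x = (\<Sum>w\<in>Poly_Mapping.keys x. tscale (Poly_Mapping.lookup x w) (deriv_letters (letters w)))"

lemma tderiv_superset:
  assumes "finite A" "Poly_Mapping.keys x \<subseteq> A"
  shows "tderiv x = (\<Sum>w\<in>A. tscale (Poly_Mapping.lookup x w) (deriv_letters (letters w)))"
  unfolding tderiv_def using assms
  by (intro sum.mono_neutral_left) (auto simp: not_in_keys_iff_lookup_eq_zero)

lemma tderiv_add: "tderiv (x + y) = tderiv x + tderiv y"
proof -
  let ?A = "Poly_Mapping.keys x \<union> Poly_Mapping.keys y"
  have "tderiv (x + y) = (\<Sum>w\<in>?A. tscale (Poly_Mapping.lookup (x + y) w) (deriv_letters (letters w)))"
    by (rule tderiv_superset) (use Poly_Mapping.keys_add[of x y] in auto)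
  moreover have "tderiv x = (\<Sum>w\<in>?A. tscale (Poly_Mapping.lookup x w) (deriv_letters (letters w)))"
    by (rule tderiv_superset) auto
  moreover have "tderiv y = (\<Sum>w\<in>?A. tscale (Poly_Mapping.lookup y w) (deriv_letters (letters w)))"
    by (rule tderiv_superset) auto
  ultimately show ?thesis
    by (simp add: lookup_add T.scale_left_distrib sum.distrib)
qed

lemma tderiv_tscale: "tderiv (tscale c x) = tscale c (tderiv x)"
proof -
  have "tderiv (tscale c x) = (\<Sum>w\<in>Poly_Mapping.keys x.
      tscale (Poly_Mapping.lookup (tscale c x) w) (deriv_letters (letters w)))"
    by (rule tderiv_superset) (auto simp: in_keys_iff)
  then show ?thesis
    by (simp add: tderiv_def T.scale_sum_right)
qed

lemma tderiv_single: "tderiv (Poly_Mapping.single w c) = tscale c (deriv_letters (letters w))"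
  using tderiv_superset[of "{w}" "Poly_Mapping.single w c"] by (simp split: if_splits)

lemma tens_induct [case_names zero single add]:
  assumes "P 0" "\<And>w c. P (Poly_Mapping.single w c)" "\<And>x y. P x \<Longrightarrow> P y \<Longrightarrow> P (x + y)"
  shows "P (x :: tens)"
proof -
  have "x = (\<Sum>w\<in>Poly_Mapping.keys x. Poly_Mapping.single w (Poly_Mapping.lookup x w))"
    by (rule poly_mapping_eqI)
      (auto simp: lookup_sum lookup_single when_def not_in_keys_iff_lookup_eq_zero)
  moreover have "P (\<Sum>w\<in>A. Poly_Mapping.single w (Poly_Mapping.lookup x w))" if "finite A" for A
    using that by induction (auto intro: assms)
  ultimately show ?thesis
    using finite_keys by metis
qed

lemma tscale_mult_right: "x * tscale c y = tscale c (x * y)"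
proof -
  have "x * Poly_Mapping.single 0 c = Poly_Mapping.single 0 c * x"
    by (induction x rule: tens_induct) (simp_all add: mult_single algebra_simps)
  then show ?thesis
    by (metis tscale_conv_mult mult.assoc)
qed

lemma tscale_single: "tscale c (Poly_Mapping.single w b) = Poly_Mapping.single w (c * b)"
  by (rule poly_mapping_eqI) (simp add: lookup_single when_def)

lemma deriv_letters_append:
  "deriv_letters (xs @ ys) = deriv_letters xs * Poly_Mapping.single (Word ys) 1
     + Poly_Mapping.single (Word xs) 1 * deriv_letters ys"
proof (induction xs)
  case Nil
  then show ?case by (simp flip: zero_word_def)
next
  case (Cons x xs)
  have 1: "Poly_Mapping.single (Word (x # xs)) 1
      = Poly_Mapping.single (Word [x]) 1 * (Poly_Mapping.single (Word xs) 1 :: tens)"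
    and 2: "Poly_Mapping.single (Word (xs @ ys)) 1
      = Poly_Mapping.single (Word xs) 1 * (Poly_Mapping.single (Word ys) 1 :: tens)"
    by (simp_all add: mult_single plus_word_def)
  show ?case
    by (simp only: append_Cons deriv_letters.simps Cons.IH 1 2 distrib_left distrib_right
        mult.assoc add.assoc)
qed

lemma tderiv_mult: "tderiv (x * y) = tderiv x * y + x * tderiv y"
proof (induction x rule: tens_induct)
  case zero
  then show ?case by (simp add: tderiv_def)
next
  case (single v b)
  show ?case
  proof (induction y rule: tens_induct)
    case zero
    then show ?case by (simp add: tderiv_def)
  next
    case (single w c)
    have *: "Poly_Mapping.single u a = tscale a (Poly_Mapping.single (Word (letters u)) 1)" for u a
      by (simp add: tscale_single)
    show ?case
      unfolding mult_single tderiv_single plus_word_def word.sel deriv_letters_append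
      by (simp only: *[of v b] *[of w c] tscale_mult_left tscale_mult_right T.scale_scale
          T.scale_right_distrib mult.commute)
  qed (simp add: tderiv_add algebra_simps)
qed (simp add: tderiv_add algebra_simps)

lemma tderiv_tmode: "tderiv (tmode u n) = tscale (- of_int n) (tmode u (n - 1))"
  by (simp add: tmode_def tderiv_add tderiv_single tscale_single T.scale_right_distrib
      zero_word_def[symmetric] mult.commute)

text \<open>
  \<open>J = \<TT> \<complex>[d] \<TT>\<^sub>-\<close>, so that the type \<open>VT\<close> below is \<open>V\<^sub>\<TT> = \<TT>/J\<close>, with \<open>vt_act\<close> the left action of \<open>\<TT>\<close>.
\<close>

definition tens_J :: "tens set" where
  "tens_J = T.span {x * (tderiv ^^ k) y |x k y. y \<in> tens_neg}"

lemma tens_J_left_ideal: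
  assumes "y \<in> tens_J" shows "x * y \<in> tens_J"
  using assms unfolding tens_J_def
proof (induction y rule: T.span_induct_alt)
  case base
  then show ?case by (simp add: T.span_zero)
next
  case (step c b y)
  then obtain z k a where b: "b = z * (tderiv ^^ k) a" "a \<in> tens_neg"
    by auto
  then have "x * b = (x * z) * (tderiv ^^ k) a"
    by (simp add: mult.assoc)
  then have "x * b \<in> {x * (tderiv ^^ k) y |x k y. y \<in> tens_neg}"
    using b by blast
  then show ?case
    unfolding distrib_left tscale_mult_right
    by (intro T.span_add T.span_scale step.IH T.span_base)
qed

lemma tens_J_0: "0 \<in> tens_J"
  and tens_J_add: "x \<in> tens_J \<Longrightarrow> y \<in> tens_J \<Longrightarrow> x + y \<in> tens_J"
  and tens_J_diff: "x \<in> tens_J \<Longrightarrow> y \<in> tens_J \<Longrightarrow> x - y \<in> tens_J"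
  and tens_J_scale: "x \<in> tens_J \<Longrightarrow> tscale c x \<in> tens_J"
  unfolding tens_J_def by (auto intro: T.span_zero T.span_add T.span_diff T.span_scale)

lemma tens_neg_subset_J: "tens_neg \<subseteq> tens_J"
proof
  fix y assume "y \<in> tens_neg"
  then have "1 * (tderiv ^^ 0) y \<in> tens_J"
    unfolding tens_J_def by (intro T.span_base) blast
  then show "y \<in> tens_J" by simp
qed

quotient_type VT = tens / "\<lambda>x y. x - y \<in> tens_J"
proof (intro equivpI reflpI sympI transpI)
  fix x y z :: tens
  show "x - x \<in> tens_J" by (simp add: tens_J_0)
  show "y - x \<in> tens_J" if "x - y \<in> tens_J"
    using tens_J_diff[OF tens_J_0 that] by simp
  show "x - z \<in> tens_J" if "x - y \<in> tens_J" "y - z \<in> tens_J"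
    using tens_J_add[OF that] by simp
qed

lifting_forget poly_mapping.lifting

instantiation VT :: ab_group_add
begin

lift_definition zero_VT :: VT is 0 .
lift_definition plus_VT :: "VT \<Rightarrow> VT \<Rightarrow> VT" is "(+)"
  by (simp only: add_diff_add tens_J_add)
lift_definition minus_VT :: "VT \<Rightarrow> VT \<Rightarrow> VT" is "(-)"
  subgoal for a b c d
    using tens_J_diff[of "a - b" "c - d"] by (simp only: diff_diff_eq2 diff_diff_eq add_diff_eq diff_add_eq ac_simps)
  done
lift_definition uminus_VT :: "VT \<Rightarrow> VT" is uminus
  subgoal for a b
    using tens_J_diff[OF tens_J_0, of "a - b"] by (simp only: minus_diff_minus diff_0)
  done
instance
  by standard (transfer; simp add: algebra_simps tens_J_0)+
end

lift_definition vt_scale :: "complex \<Rightarrow> VT \<Rightarrow> VT" is tscale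
  by (metis T.scale_right_diff_distrib tens_J_scale)

lift_definition vt_act :: "tens \<Rightarrow> VT \<Rightarrow> VT" is "(*)"
  by (metis right_diff_distrib tens_J_left_ideal)

lift_definition vt_vac :: VT is 1 .

interpretation VT: vector_space vt_scale
  by standard (transfer; simp add: algebra_simps T.scale_right_distrib T.scale_left_distrib tens_J_0)+

lemma vt_act_one [simp]: "vt_act 1 v = v"
  and vt_act_mult: "vt_act (x * y) v = vt_act x (vt_act y v)"
  and vt_act_add_left: "vt_act (x + y) v = vt_act x v + vt_act y v"
  and vt_act_add_right: "vt_act x (v + w) = vt_act x v + vt_act x w"
  and vt_act_tscale: "vt_act (tscale c x) v = vt_scale c (vt_act x v)"
  and vt_act_vt_scale: "vt_act x (vt_scale c v) = vt_scale c (vt_act x v)"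
  by (transfer; simp add: algebra_simps tscale_mult_left tscale_mult_right tens_J_0)+

text \<open>
  The coefficient of \<open>x\<^sup>i y\<^sup>j\<close> in \<open>h(x - y) = (\<Sum>k. h\<^sub>k (x - y)\<^sup>k) \<in> \<complex>[[x,y]]\<close>; only \<open>k = i + j\<close>
  contributes.  For \<open>h(w - z)\<close> the coefficient of \<open>z\<^sup>i w\<^sup>j\<close> is therefore \<open>diff_coeff h j i\<close>.
\<close>

definition diff_coeff :: "complex fps \<Rightarrow> nat \<Rightarrow> nat \<Rightarrow> complex" where
  "diff_coeff h i j = fps_nth h (i + j) * of_nat ((i + j) choose i) * (- 1) ^ j"

lemma fps_diff_power_nth:
  "fps_nth (fps_nth ((fps_const fps_X - fps_X :: complex fps fps) ^ k) j) i
     = (if i + j = k then of_nat (k choose i) * (- 1) ^ j else 0)"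
proof (induction k arbitrary: i j)
  case 0
  then show ?case by auto
next
  case (Suc k)
  let ?P = "(fps_const fps_X - fps_X :: complex fps fps) ^ k"
  have "fps_nth (fps_nth ((fps_const fps_X - fps_X :: complex fps fps) ^ Suc k) j) i
      = (if i = 0 then 0 else fps_nth (fps_nth ?P j) (i - 1))
        - (if j = 0 then 0 else fps_nth (fps_nth ?P (j - 1)) i)"
    by (simp add: algebra_simps)
  then show ?case
    by (cases i; cases j) (auto simp: Suc algebra_simps)
qed

text \<open>
  With \<open>a(z) = (\<Sum>n. a\<^sub>n z\<^sup>-\<^sup>n\<^sup>-\<^sup>1)\<close>, this is the coefficient of \<open>z\<^sup>-\<^sup>m\<^sup>-\<^sup>1 w\<^sup>-\<^sup>n\<^sup>-\<^sup>1\<close> in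
  \<open>a(z) b(w) - c(z,w) b(w) a(z)\<close>, applied to \<open>v\<close>, where \<open>c i j\<close> is the coefficient of
  \<open>z\<^sup>i w\<^sup>j\<close> in \<open>c(z,w)\<close>.  The sum has finitely many nonzero terms; see
  \<open>finite_exchange\<close> below.  (\<open>Sum_any\<close> would be \<open>0\<close> on an infinite support.)
\<close>

definition exchange ::
    "(nat \<Rightarrow> nat \<Rightarrow> complex) \<Rightarrow> gen \<Rightarrow> gen \<Rightarrow> int \<Rightarrow> int \<Rightarrow> VT \<Rightarrow> VT" where
  "exchange c a b m n v =
     vt_act (tmode (U_basis a) m * tmode (U_basis b) n) v
     - (\<Sum>(i, j). vt_scale (c i j)
          (vt_act (tmode (U_basis b) (n + int j) * tmode (U_basis a) (m + int i)) v))"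

lemma span_tens_neg: "x \<in> tens_neg" if "\<And>w. w \<in> Poly_Mapping.keys x \<Longrightarrow> word_deg w < 0"
proof -
  have "x = (\<Sum>w\<in>Poly_Mapping.keys x. Poly_Mapping.single w (Poly_Mapping.lookup x w))"
    by (rule poly_mapping_eqI)
      (auto simp: lookup_sum lookup_single when_def not_in_keys_iff_lookup_eq_zero)
  also have "\<dots> \<in> tens_neg"
    unfolding tens_neg_def
  proof (intro T.span_sum T.span_base UN_I)
    fix w assume "w \<in> Poly_Mapping.keys x"
    then show "- word_deg w \<in> {1..}" "Poly_Mapping.single w (Poly_Mapping.lookup x w) \<in> tens_deg (- (- word_deg w))"
      using that by (fastforce simp: tens_deg_def)+
  qed
  finally show ?thesis .
qed

lemma finite_exchange:
  "finite {(i, j). vt_scale (c i j)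
     (vt_act (tmode (U_basis b) (n + int j) * tmode (U_basis a) (m + int i)) v) \<noteq> 0}"
proof -
  obtain x where v: "v = abs_VT x"
    using Quotient_abs_rep[OF Quotient_VT, of v] by metis
  define D where "D = Max (insert 0 (word_deg ` Poly_Mapping.keys x))"
  have D: "word_deg w \<le> D" if "w \<in> Poly_Mapping.keys x" for w
    unfolding D_def using that by simp
  define N where "N = nat (D + 1 + \<bar>m\<bar> + \<bar>n\<bar>)"
  have zero: "vt_act (tmode (U_basis b) (n + int j) * tmode (U_basis a) (m + int i)) v = 0"
    if "i > N \<or> j > N" for i j
  proof -
    let ?p = "tmode (U_basis b) (n + int j) * tmode (U_basis a) (m + int i)"
    let ?w = "Word [(b, n + int j), (a, m + int i)]"
    have p: "?p = Poly_Mapping.single ?w 1"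
      by (simp add: tmode_U_basis mult_single plus_word_def)
    have "?p * x \<in> tens_neg"
    proof (rule span_tens_neg)
      fix w assume "w \<in> Poly_Mapping.keys (?p * x)"
      then obtain u where u: "u \<in> Poly_Mapping.keys x" "w = ?w + u"
        unfolding p using Poly_Mapping.keys_mult[of "Poly_Mapping.single ?w 1" x] by auto
      have "word_deg w = - (n + int j) - (m + int i) + word_deg u"
        by (simp add: u word_deg_def plus_word_def)
      then show "word_deg w < 0"
        using D[OF u(1)] that unfolding N_def by linarith
    qed
    then have "?p * x \<in> tens_J"
      using tens_neg_subset_J by blast
    then show ?thesis
      unfolding v by (simp add: vt_act.abs_eq zero_VT_def VT.abs_eq_iff)
  qed
  show ?thesis
  proof (rule finite_subset)
    show "{(i, j). vt_scale (c i j)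
      (vt_act (tmode (U_basis b) (n + int j) * tmode (U_basis a) (m + int i)) v) \<noteq> 0} \<subseteq> {..N} \<times> {..N}"
    proof (rule subrelI, drule CollectD, unfold prod.case)
      fix i j assume "vt_scale (c i j)
        (vt_act (tmode (U_basis b) (n + int j) * tmode (U_basis a) (m + int i)) v) \<noteq> 0"
      then have "\<not> (i > N \<or> j > N)"
        using zero[of i j] VT.scale_zero_right by metis
      then show "(i, j) \<in> {..N} \<times> {..N}" by simp
    qed
  qed simp
qed

text \<open>
  In the relation for \<open>[e(z), f(w)]\<close>, the coefficient of \<open>z\<^sup>-\<^sup>m\<^sup>-\<^sup>1 w\<^sup>-\<^sup>n\<^sup>-\<^sup>1\<close> in
  \<open>z\<^sup>-\<^sup>1 \<delta>(w/z) \<psi>(z)\<close> is \<open>\<psi>\<^sub>m\<^sub>+\<^sub>n\<close>.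
\<close>

inductive_set relators :: "complex fps \<Rightarrow> VT set" for h where
  ee: "exchange (\<lambda>i j. diff_coeff h j i) gen_e gen_e m n v \<in> relators h"
| ff: "exchange (\<lambda>i j. diff_coeff h i j) gen_f gen_f m n v \<in> relators h"
| psi_e: "exchange (\<lambda>i j. diff_coeff h j i) gen_psi gen_e m n v \<in> relators h"
| psi_f: "exchange (\<lambda>i j. diff_coeff h i j) gen_psi gen_f m n v \<in> relators h"
| ef: "vt_act (tmode (U_basis gen_e) m * tmode (U_basis gen_f) n
        - tmode (U_basis gen_f) n * tmode (U_basis gen_e) m
        - tmode (U_basis gen_psi) (m + n)) v \<in> relators h"
| psi_psi: "vt_act (tmode (U_basis gen_psi) m * tmode (U_basis gen_psi) n
        - tmode (U_basis gen_psi) n * tmode (U_basis gen_psi) m) v \<in> relators h"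

definition rel_submodule :: "complex fps \<Rightarrow> VT set" where
  "rel_submodule h = VT.span {vt_act x r |x r. r \<in> relators h}"

definition va_class :: "complex fps \<Rightarrow> VT \<Rightarrow> VT set" where
  "va_class h v = {v + r |r. r \<in> rel_submodule h}"

text \<open>
  The quotient of \<open>V\<^sub>\<TT>\<close> by the submodule of the relations, with cosets as vectors, as a vector space in the sense of \<^locale>\<open>vectorspace\<close>; the fields
  \<^const>\<open>monoid.mult\<close> and \<^const>\<open>monoid.one\<close> of the record play no role there.
\<close>

definition VA :: "complex fps \<Rightarrow> (complex, VT set) module" where
  "VA h = \<lparr>carrier = range (va_class h),
     mult = (\<lambda>X Y. va_class h 0), one = va_class h 0,
     zero = va_class h 0,
     add = (\<lambda>X Y. \<Union>v\<in>X. \<Union>w\<in>Y. va_class h (v + w)),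
     smult = (\<lambda>c X. \<Union>v\<in>X. va_class h (vt_scale c v))\<rparr>"

definition va_vac :: "complex fps \<Rightarrow> VT set" where
  "va_vac h = va_class h vt_vac"

definition va_act :: "complex fps \<Rightarrow> tens \<Rightarrow> VT set \<Rightarrow> VT set" where
  "va_act h x X = (\<Union>v\<in>X. va_class h (vt_act x v))"

definition va_mode :: "complex fps \<Rightarrow> U \<Rightarrow> int \<Rightarrow> VT set \<Rightarrow> VT set" where
  "va_mode h u n = va_act h (tmode u n)"

lemma rel_submodule_0: "0 \<in> rel_submodule h"
  and rel_submodule_add: "v \<in> rel_submodule h \<Longrightarrow> w \<in> rel_submodule h \<Longrightarrow> v + w \<in> rel_submodule h"
  and rel_submodule_diff: "v \<in> rel_submodule h \<Longrightarrow> w \<in> rel_submodule h \<Longrightarrow> v - w \<in> rel_submodule h"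
  and rel_submodule_scale: "v \<in> rel_submodule h \<Longrightarrow> vt_scale c v \<in> rel_submodule h"
  unfolding rel_submodule_def by (auto intro: VT.span_zero VT.span_add VT.span_diff VT.span_scale)

lemma rel_submodule_act:
  assumes "v \<in> rel_submodule h" shows "vt_act x v \<in> rel_submodule h"
  using assms unfolding rel_submodule_def
proof (induction v rule: VT.span_induct_alt)
  case base
  have "vt_act x 0 = 0"
    using vt_act_add_right[of x 0 0] by simp
  then show ?case by (simp add: VT.span_zero)
next
  case (step c b y)
  then have "vt_act x b \<in> {vt_act x r |x r. r \<in> relators h}"
    by clarsimp (metis vt_act_mult)
  then show ?case
    unfolding vt_act_add_right vt_act_vt_scale
    by (intro VT.span_add VT.span_scale step.IH VT.span_base)
qed

lemma va_class_iff: "x \<in> va_class h v \<longleftrightarrow> x - v \<in> rel_submodule h"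
proof
  show "x - v \<in> rel_submodule h" if "x \<in> va_class h v"
    using that by (auto simp: va_class_def)
  have "x = v + (x - v)" by simp
  then show "x \<in> va_class h v" if "x - v \<in> rel_submodule h"
    using that unfolding va_class_def by blast
qed

lemma va_class_self: "v \<in> va_class h v"
  by (simp add: va_class_iff rel_submodule_0)

lemma va_class_eq_iff: "va_class h v = va_class h w \<longleftrightarrow> v - w \<in> rel_submodule h"
proof
  assume "va_class h v = va_class h w"
  then have "v \<in> va_class h w"
    using va_class_self[of v h] by (simp only:)
  then show "v - w \<in> rel_submodule h"
    by (simp only: va_class_iff)
next
  assume *: "v - w \<in> rel_submodule h"
  have "x - v \<in> rel_submodule h \<longleftrightarrow> x - w \<in> rel_submodule h" for x
  proof
    show "x - w \<in> rel_submodule h" if "x - v \<in> rel_submodule h"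
      using rel_submodule_add[OF that *] by (simp only: diff_add_eq_diff_diff_swap add_diff_eq diff_add_cancel)
    show "x - v \<in> rel_submodule h" if "x - w \<in> rel_submodule h"
      using rel_submodule_diff[OF that *] by (simp only: diff_diff_eq2 diff_add_cancel)
  qed
  then show "va_class h v = va_class h w"
    by (simp only: set_eq_iff va_class_iff simp_thms)
qed

lemma va_class_nonempty: "va_class h v \<noteq> {}"
  using va_class_self by blast

lemma va_class_UN:
  assumes "\<And>x. x \<in> va_class h v \<Longrightarrow> f x = c"
  shows "(\<Union>x\<in>va_class h v. f x) = c"
  using assms by (intro UN_constant_eq[OF va_class_self]) blast

lemma VA_add: "va_class h v \<oplus>\<^bsub>VA h\<^esub> va_class h w = va_class h (v + w)"
proof -
  have *: "va_class h (v' + w') = va_class h (v + w)" if "v' \<in> va_class h v" "w' \<in> va_class h w" for v' w'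
    using rel_submodule_add[OF that[unfolded va_class_iff]]
    by (simp add: va_class_eq_iff algebra_simps)
  have "(\<Union>w'\<in>va_class h w. va_class h (v' + w')) = va_class h (v + w)" if "v' \<in> va_class h v" for v'
    by (rule va_class_UN[OF *[OF that]])
  then show ?thesis
    by (simp add: VA_def va_class_UN va_class_nonempty)
qed

lemma VA_smult: "c \<odot>\<^bsub>VA h\<^esub> va_class h v = va_class h (vt_scale c v)"
proof -
  have "va_class h (vt_scale c v') = va_class h (vt_scale c v)" if "v' \<in> va_class h v" for v'
    using rel_submodule_scale[OF that[unfolded va_class_iff], of c]
    by (simp add: va_class_eq_iff VT.scale_right_diff_distrib)
  then show ?thesis
    by (simp add: VA_def va_class_UN va_class_nonempty)
qed

lemma va_act_class: "va_act h x (va_class h v) = va_class h (vt_act x v)"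
proof -
  have "va_class h (vt_act x v') = va_class h (vt_act x v)" if "v' \<in> va_class h v" for v'
    using rel_submodule_act[OF that[unfolded va_class_iff], of x] vt_act_add_right[of x "v' - v" v]
    by (simp add: va_class_eq_iff)
  then show ?thesis
    by (simp add: va_act_def va_class_UN va_class_nonempty)
qed

lemma VA_carrier: "carrier (VA h) = range (va_class h)"
  and VA_zero: "\<zero>\<^bsub>VA h\<^esub> = va_class h 0"
  by (simp_all add: VA_def)

lemma VA_vectorspace: "vectorspace class_ring (VA h)"
proof -
  have "abelian_group (VA h)"
  proof (rule abelian_groupI)
    fix X assume "X \<in> carrier (VA h)"
    then obtain v where "X = va_class h v" by (auto simp: VA_carrier)
    then show "\<exists>Y\<in>carrier (VA h). Y \<oplus>\<^bsub>VA h\<^esub> X = \<zero>\<^bsub>VA h\<^esub>"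
      by (intro bexI[of _ "va_class h (- v)"]) (auto simp: VA_carrier VA_add VA_zero)
  qed (auto simp: VA_carrier VA_add VA_zero ac_simps)
  then have "module class_ring (VA h)"
    by (intro moduleI fieldE(1)[OF class_field])
      (auto simp: VA_carrier VA_add VA_smult VT.scale_left_distrib VT.scale_right_distrib)
  then show ?thesis
    by (simp add: vectorspace_def class_field)
qed

definition E_filt :: "complex fps \<Rightarrow> nat \<Rightarrow> VT set set" where
  "E_filt h n = LinearCombinations.module.span class_ring (VA h)
     {foldr (\<lambda>(u, m). va_mode h u m) us (va_vac h) |us. length us \<le> n}"

text \<open>
  The vector \<open>e(-m\<^sub>1)\<cdots>e(-m\<^sub>r) f(-n\<^sub>1)\<cdots>f(-n\<^sub>s) \<psi>(-k\<^sub>1)\<cdots>\<psi>(-k\<^sub>l)\<one>\<close>, for the lists of the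
  \<open>m\<^sub>i\<close>, the \<open>n\<^sub>j\<close> and the \<open>k\<^sub>t\<close>.
\<close>

definition pbw_vector :: "complex fps \<Rightarrow> nat list \<times> nat list \<times> nat list \<Rightarrow> VT set" where
  "pbw_vector h = (\<lambda>(ms, ns, ks).
     foldr (\<lambda>m. va_mode h (U_basis gen_e) (- int m)) ms
       (foldr (\<lambda>m. va_mode h (U_basis gen_f) (- int m)) ns
         (foldr (\<lambda>m. va_mode h (U_basis gen_psi) (- int m)) ks (va_vac h))))"

definition decreasing_pos :: "nat list \<Rightarrow> bool" where
  "decreasing_pos ms \<longleftrightarrow> sorted_wrt (\<ge>) ms \<and> (\<forall>m\<in>set ms. m \<ge> 1)"

definition pbw_index :: "nat \<Rightarrow> (nat list \<times> nat list \<times> nat list) set" where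
  "pbw_index n = {(ms, ns, ks). decreasing_pos ms \<and> decreasing_pos ns \<and> decreasing_pos ks
     \<and> length ms + length ns + length ks \<le> n}"

end

theory Submission
  imports Defs
begin

text \<open>
  Spanning: modulo words of smaller length and words of the same length but smaller degree,
  all letters commute, because \<open>h(0) = 1\<close>.  Hence a word with a mode \<open>u(n)\<close>, \<open>n \<ge> 0\<close>, may be
  rearranged so that \<open>u(n)\<close> hits the vacuum, and any other word may be sorted.  The induction
  ends because words of negative degree kill the vacuum.

  Independence: a representation is built on polynomials in variables \<open>b\<^sub>m\<close>, \<open>c\<^sub>m\<close>, \<open>x\<^sub>m\<close>, \<open>y\<^sub>m\<close>
  (\<open>m \<ge> 0\<close>).  With \<open>b(z) = (\<Sum>m. b\<^sub>m z\<^sup>m)\<close> and so on, let \<open>\<beta>(z)\<close> and \<open>\<gamma>(z)\<close> be the free fields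
  \<open>x(z) + (\<Sum>n. z\<^sup>-\<^sup>n\<^sup>-\<^sup>1 \<partial>/\<partial>y\<^sub>n)\<close> and \<open>y(z) - (\<Sum>n. z\<^sup>-\<^sup>n\<^sup>-\<^sup>1 \<partial>/\<partial>x\<^sub>n)\<close>, so that
  \<open>[\<beta>(z), \<gamma>(w)] = z\<^sup>-\<^sup>1 \<delta>(w/z)\<close>.  Let \<open>\<Phi>(z)\<close> and \<open>\<Psi>(z)\<close> be the ring homomorphisms with
  \<open>b(w) \<mapsto> q(z - w) b(w)\<close> and \<open>c(w) \<mapsto> q(w - z) c(w)\<close> respectively, the other variables being fixed.
  Then \<open>e(z) = b(z) \<Phi>(z) \<beta>(z)\<close>, \<open>f(z) = c(z) \<Psi>(z) \<gamma>(z)\<close>, \<open>\<psi>(z) = b(z) c(z) \<Phi>(z) \<Psi>(z)\<close> satisfy the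
  relations of \<open>\<A>(h)\<close>; only nonnegative powers of \<open>z\<close> occur in the twisting factors, so they
  never interfere with the annihilation operators.  The constant \<open>1\<close> is killed by \<open>J\<close>, by degree and
  because the derivation \<open>v\<^sub>m \<mapsto> (m + 1) v\<^sub>m\<^sub>+\<^sub>1\<close> implements \<open>d\<close>.  For a suitable weight the
  leading monomials of \<open>e(-m)\<close>, \<open>f(-m)\<close>, \<open>\<psi>(-m)\<close> are \<open>b\<^sub>0 x\<^sub>m\<^sub>-\<^sub>1\<close>, \<open>c\<^sub>0 y\<^sub>m\<^sub>-\<^sub>1\<close>, \<open>b\<^sub>0 c\<^sub>m\<^sub>-\<^sub>1\<close>, and
  their products determine the three lists.
\<close>

section \<open>The polynomial Fock space\<close>

datatype fvar_kind = Fb | Fc | Fx | Fy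

type_synonym fvar = "fvar_kind \<times> nat"
type_synonym fock = "fvar multiset \<Rightarrow>\<^sub>0 complex"

abbreviation cst :: "complex \<Rightarrow> fock" where
  "cst c \<equiv> Poly_Mapping.single {#} c"

abbreviation pmon :: "fvar multiset \<Rightarrow> fock" where
  "pmon M \<equiv> Poly_Mapping.single M 1"

abbreviation pvar :: "fvar \<Rightarrow> fock" where
  "pvar v \<equiv> pmon {#v#}"

lemma cst_0 [simp]: "cst 0 = 0"
  and cst_1: "cst 1 = 1"
  and cst_add: "cst (c + d) = cst c + cst d"
  and cst_mult: "cst (c * d) = cst c * cst d"
  and cst_uminus: "cst (- c) = - cst c"
  by (simp_all add: single_add mult_single single_uminus)

lemma mon_add_mset: "pmon (add_mset v M) = pvar v * pmon M"
  by (simp add: mult_single)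

lemma fock_single_induct [case_names single add]:
  assumes "\<And>M c. P (Poly_Mapping.single M c)" "\<And>p q. P p \<Longrightarrow> P q \<Longrightarrow> P (p + q)"
  shows "P (p :: fock)"
proof -
  have "p = (\<Sum>w\<in>Poly_Mapping.keys p. Poly_Mapping.single w (Poly_Mapping.lookup p w))"
    by (rule poly_mapping_eqI)
      (auto simp: lookup_sum lookup_single when_def not_in_keys_iff_lookup_eq_zero)
  moreover have "P (\<Sum>w\<in>A. Poly_Mapping.single w (Poly_Mapping.lookup p w))" if "finite A" for A
    using that by induction (auto intro: assms assms(1)[of _ 0, unfolded single_zero])
  ultimately show ?thesis
    using finite_keys by metis
qed

lemma fock_induct [case_names cst var add]:
  assumes "\<And>c. P (cst c)" "\<And>v p. P p \<Longrightarrow> P (pvar v * p)" "\<And>p q. P p \<Longrightarrow> P q \<Longrightarrow> P (p + q)"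
  shows "P p"
proof (induction p rule: fock_single_induct)
  case (single M c)
  show ?case
  proof (induction M)
    case (add v M)
    have "Poly_Mapping.single (add_mset v M) c = pvar v * Poly_Mapping.single M c"
      by (simp add: mult_single)
    then show ?case using assms(2)[OF add] by simp
  qed (use assms(1) in simp)
qed (rule assms(3))

section \<open>Linear maps, substitutions and derivations of the polynomial ring\<close>

definition fock_linear :: "(fock \<Rightarrow> fock) \<Rightarrow> bool" where
  "fock_linear f \<longleftrightarrow> (\<forall>p q. f (p + q) = f p + f q) \<and> (\<forall>c p. f (cst c * p) = cst c * f p)"

lemma fock_linear_add: "fock_linear f \<Longrightarrow> f (p + q) = f p + f q"
  and fock_linear_cst: "fock_linear f \<Longrightarrow> f (cst c * p) = cst c * f p"
  by (simp_all add: fock_linear_def)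

lemma fock_linear_0: "fock_linear f \<Longrightarrow> f 0 = 0"
  using fock_linear_cst[of f 0 0] by simp

lemma fock_linear_uminus: "fock_linear f \<Longrightarrow> f (- p) = - f p"
  using fock_linear_cst[of f "-1" p] by (simp add: cst_uminus cst_1)

lemma fock_linear_diff: "fock_linear f \<Longrightarrow> f (p - q) = f p - f q"
  using fock_linear_add[of f p "- q"] by (simp add: fock_linear_uminus)

lemma fock_linear_sum: "fock_linear f \<Longrightarrow> f (sum g A) = (\<Sum>i\<in>A. f (g i))"
  by (induction A rule: infinite_finite_induct) (simp_all add: fock_linear_0 fock_linear_add)

text \<open>The algebra homomorphism with \<open>v\<close> \<mapsto> \<open>g v\<close>. Values in
  power series let it serve both for the shifts and, through first-order coefficients, for all
  derivations.\<close>

definition fsubst :: "(fvar \<Rightarrow> fock fps) \<Rightarrow> fock \<Rightarrow> fock fps" where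
  "fsubst g p = (\<Sum>M\<in>Poly_Mapping.keys p.
     fps_const (cst (Poly_Mapping.lookup p M)) * prod_mset (image_mset g M))"

lemma fsubst_superset:
  assumes "finite A" "Poly_Mapping.keys p \<subseteq> A"
  shows "fsubst g p = (\<Sum>M\<in>A. fps_const (cst (Poly_Mapping.lookup p M)) * prod_mset (image_mset g M))"
  unfolding fsubst_def using assms
  by (intro sum.mono_neutral_left) (auto simp: not_in_keys_iff_lookup_eq_zero)

lemma fsubst_single:
  "fsubst g (Poly_Mapping.single M c) = fps_const (cst c) * prod_mset (image_mset g M)"
  using fsubst_superset[of "{M}" "Poly_Mapping.single M c" g] by (simp split: if_splits)

lemma fsubst_add: "fsubst g (p + q) = fsubst g p + fsubst g q"
proof -
  let ?A = "Poly_Mapping.keys p \<union> Poly_Mapping.keys q"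
  have "Poly_Mapping.keys (p + q) \<subseteq> ?A"
    by (rule Poly_Mapping.keys_add)
  then show ?thesis
    using fsubst_superset[of ?A p g] fsubst_superset[of ?A q g] fsubst_superset[of ?A "p + q" g]
    by (simp add: lookup_add cst_add sum.distrib algebra_simps flip: fps_const_add)
qed

lemma fsubst_cst: "fsubst g (cst c) = fps_const (cst c)"
  and fsubst_var: "fsubst g (pvar v) = g v"
  by (simp_all add: fsubst_single cst_1)

lemma fsubst_mult: "fsubst g (p * q) = fsubst g p * fsubst g q"
proof (induction p rule: fock_single_induct)
  case (single M c)
  show ?case
  proof (induction q rule: fock_single_induct)
    case (single N d)
    then show ?case
      unfolding mult_single fsubst_single
      by (simp only: cst_mult fps_const_mult[symmetric] image_mset_union prod_mset.union ac_simps)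
  qed (simp add: fsubst_add algebra_simps)
qed (simp add: fsubst_add algebra_simps)

lemma fsubst_nth_linear: "fock_linear (\<lambda>p. fps_nth (fsubst g p) i)"
  by (simp add: fock_linear_def fsubst_add fsubst_mult fsubst_cst)

text \<open>The derivation with \<open>v\<close> \<mapsto> \<open>g v\<close>, read off as the
  first-order coefficient of the substitution v \<mapsto> v + t g(v).\<close>

definition fderiv :: "(fvar \<Rightarrow> fock) \<Rightarrow> fock \<Rightarrow> fock" where
  "fderiv g p = fps_nth (fsubst (\<lambda>v. fps_const (pvar v) + fps_X * fps_const (g v)) p) 1"

lemma fderiv_linear: "fock_linear (fderiv g)"
  unfolding fderiv_def by (rule fsubst_nth_linear)

lemma fderiv_cst: "fderiv g (cst c) = 0"
  and fderiv_var: "fderiv g (pvar v) = g v"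
  by (simp_all add: fderiv_def fsubst_cst fsubst_var)

lemma fderiv_mult: "fderiv g (p * q) = fderiv g p * q + p * fderiv g q"
proof -
  \<comment> \<open>At t = 0 the substitution is the identity, so the Leibniz rule becomes the
    product rule for first-order coefficients.\<close>
  have "fps_nth (fsubst (\<lambda>v. fps_const (pvar v) + fps_X * fps_const (g v)) p) 0 = p" for p
    by (induction p rule: fock_induct) (simp_all add: fsubst_cst fsubst_var fsubst_mult fsubst_add)
  then show ?thesis
    by (simp add: fderiv_def fsubst_mult fps_mult_nth_1)
qed

section \<open>Coefficientwise maps\<close>

definition fps_map :: "('a \<Rightarrow> 'b) \<Rightarrow> 'a fps \<Rightarrow> 'b fps" where
  "fps_map f F = Abs_fps (\<lambda>n. f (fps_nth F n))"

lemma fps_map_nth [simp]: "fps_nth (fps_map f F) n = f (fps_nth F n)"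
  by (simp add: fps_map_def)

lemma fps_map_mult:
  fixes f :: "'a :: comm_ring_1 \<Rightarrow> 'b :: comm_ring_1"
  assumes add: "\<And>x y. f (x + y) = f x + f y" and mult: "\<And>x y. f (x * y) = f x * f y"
  shows "fps_map f (F * G) = fps_map f F * fps_map f G"
proof (rule fps_ext)
  have "f 0 = 0" using add[of 0 0] by simp
  then have "f (sum u A) = (\<Sum>i\<in>A. f (u i))" for u :: "nat \<Rightarrow> 'a" and A
    by (induction A rule: infinite_finite_induct) (simp_all add: add)
  then show "fps_nth (fps_map f (F * G)) n = fps_nth (fps_map f F * fps_map f G) n" for n
    by (simp add: fps_mult_nth mult)
qed

text \<open>Series in z and w are nested: the inner index counts powers of z, the outer one powers
  of w. Here the two variables exchange roles.\<close>

definition fps_swap :: "'a fps fps \<Rightarrow> 'a fps fps" where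
  "fps_swap F = Abs_fps (\<lambda>j. Abs_fps (\<lambda>i. fps_nth (fps_nth F i) j))"

lemma fps_swap_nth [simp]: "fps_nth (fps_nth (fps_swap F) j) i = fps_nth (fps_nth F i) j"
  by (simp add: fps_swap_def)

lemma fps_swap_swap [simp]: "fps_swap (fps_swap F) = F"
  by (intro fps_ext) simp

lemma fps_nth_nth_mult:
  "fps_nth (fps_nth (F * G) j) i
     = (\<Sum>l\<le>j. \<Sum>k\<le>i. fps_nth (fps_nth F l) k * fps_nth (fps_nth G (j - l)) (i - k))"
  by (simp add: fps_mult_nth fps_sum_nth atLeast0AtMost)

lemma fps_swap_mult: "fps_swap (F * G) = fps_swap F * fps_swap (G :: 'a :: comm_ring_1 fps fps)"
proof (intro fps_ext)
  show "fps_nth (fps_nth (fps_swap (F * G)) j) i = fps_nth (fps_nth (fps_swap F * fps_swap G) j) i" for i j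
    unfolding fps_swap_nth fps_nth_nth_mult by (rule sum.swap)
qed

text \<open>Restriction of a series in z and w to w = z.\<close>

definition fps_diag :: "'a :: comm_ring_1 fps fps \<Rightarrow> 'a fps" where
  "fps_diag F = Abs_fps (\<lambda>n. \<Sum>j\<le>n. fps_nth (fps_nth F j) (n - j))"

lemma fps_diag_add: "fps_diag (F + G) = fps_diag F + fps_diag G"
  by (rule fps_ext) (simp add: fps_diag_def sum.distrib)

lemma fps_diag_mult: "fps_diag (F * G) = fps_diag F * fps_diag G"
proof (rule fps_ext)
  fix n
  define t where "t = (\<lambda>i a k c. fps_nth (fps_nth F i) a * fps_nth (fps_nth G k) c)"
  have "fps_nth (fps_diag (F * G)) n = (\<Sum>j\<le>n. \<Sum>i\<le>j. \<Sum>a\<le>n - j. t i a (j - i) (n - j - a))"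
    by (simp add: fps_diag_def fps_nth_nth_mult t_def)
  also have "\<dots> = (\<Sum>(j, i, a)\<in>(SIGMA j:{..n}. {..j} \<times> {..n - j}). t i a (j - i) (n - j - a))"
    by (simp add: sum.Sigma sum.cartesian_product split_def)
  \<comment> \<open>\<open>M = i + a\<close> is the total degree contributed by \<open>F\<close>;
    summing over it first separates the two diagonals.\<close>
  also have "\<dots> = (\<Sum>(M, i, k)\<in>(SIGMA M:{..n}. {..M} \<times> {..n - M}). t i (M - i) k (n - M - k))"
    by (rule sum.reindex_bij_witness[where i = "\<lambda>(M, i, k). (i + k, i, M - i)"
          and j = "\<lambda>(j, i, a). (i + a, i, j - i)"]) (auto simp: add.commute)
  also have "\<dots> = (\<Sum>M\<le>n. \<Sum>i\<le>M. \<Sum>k\<le>n - M. t i (M - i) k (n - M - k))"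
    by (simp add: sum.Sigma sum.cartesian_product split_def)
  also have "\<dots> = fps_nth (fps_diag F * fps_diag G) n"
    by (simp add: fps_diag_def fps_mult_nth sum_product t_def atLeast0AtMost)
  finally show "fps_nth (fps_diag (F * G)) n = fps_nth (fps_diag F * fps_diag G) n" .
qed

section \<open>Power series in the difference z - w\<close>

definition diff_series :: "complex fps \<Rightarrow> complex fps fps" where
  "diff_series a = Abs_fps (\<lambda>j. Abs_fps (\<lambda>i. diff_coeff a i j))"

lemma diff_series_nth [simp]: "fps_nth (fps_nth (diff_series a) j) i = diff_coeff a i j"
  by (simp add: diff_series_def)

text \<open>Coefficients of total degree at most \<open>N\<close> only see the truncations
  \<open>T a\<close> and \<open>T b\<close>. These are polynomials in z - w, whose coefficients are
  given by \<open>fps_diff_power_nth\<close>.\<close>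

lemma diff_series_mult: "diff_series (a * b) = diff_series a * diff_series b"
proof (intro fps_ext)
  fix i j :: nat
  define N where "N = i + j"
  define Z where "Z = (fps_const fps_X - fps_X :: complex fps fps)"
  define T where "T = (\<lambda>a :: complex fps. \<Sum>k\<le>N. fps_const (fps_const (fps_nth a k)) * Z ^ k)"
  have T: "fps_nth (fps_nth (T a) l) k = diff_coeff a k l" if "k + l \<le> N" for a k l
    using that by (simp add: T_def fps_sum_nth Z_def fps_diff_power_nth diff_coeff_def if_distrib
        sum.delta mult.assoc cong: if_cong)
  have "fps_nth (fps_nth (diff_series a * diff_series b) j) i = fps_nth (fps_nth (T a * T b) j) i"
    unfolding fps_nth_nth_mult by (intro sum.cong refl) (auto simp: T N_def)
  also have "T a * T b = (\<Sum>k\<le>N. \<Sum>l\<le>N. fps_const (fps_const (fps_nth a k * fps_nth b l)) * Z ^ (k + l))"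
    unfolding T_def sum_product by (intro sum.cong refl) (simp add: power_add ac_simps flip: fps_const_mult)
  also have "fps_nth (fps_nth \<dots> j) i
      = (\<Sum>k\<le>N. \<Sum>l\<le>N. if l = N - k then fps_nth a k * fps_nth b l * (of_nat (N choose i) * (- 1) ^ j) else 0)"
    unfolding fps_sum_nth Z_def by (intro sum.cong refl) (auto simp: fps_diff_power_nth N_def)
  also have "\<dots> = diff_coeff (a * b) i j"
    by (simp add: sum.delta diff_coeff_def fps_mult_nth N_def atLeast0AtMost sum_distrib_right mult.assoc)
  finally show "fps_nth (fps_nth (diff_series (a * b)) j) i = fps_nth (fps_nth (diff_series a * diff_series b) j) i"
    by simp
qed

lemma diff_coeff_1: "diff_coeff 1 i j = (if i = 0 \<and> j = 0 then 1 else 0)"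
  by (simp add: diff_coeff_def)

text \<open>Exchanging z and w turns a(z - w) into a(w - z), the value at z - w of a(-x).\<close>

lemma fps_swap_diff_series: "fps_swap (diff_series a) = diff_series (fps_compose a (- fps_X))"
proof (intro fps_ext)
  fix i j :: nat
  have "(- 1) ^ (i + j) * (- 1) ^ j = ((- 1) ^ i :: complex)"
    by (simp add: power_add mult.assoc flip: power_mult_distrib)
  moreover have "i + j choose j = (i + j choose i)"
    using binomial_symmetric[of i "i + j"] by simp
  ultimately show "fps_nth (fps_nth (fps_swap (diff_series a)) j) i
      = fps_nth (fps_nth (diff_series (fps_compose a (- fps_X))) j) i"
    by (simp add: diff_coeff_def fps_compose_uminus' add.commute[of j i] mult_ac)
qed

definition fock_series :: "complex fps fps \<Rightarrow> fock fps fps" where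
  "fock_series = fps_map (fps_map cst)"

lemma fock_series_nth [simp]: "fps_nth (fps_nth (fock_series F) j) i = cst (fps_nth (fps_nth F j) i)"
  by (simp add: fock_series_def)

lemma fps_map_cst_add: "fps_map cst (F + G) = fps_map cst F + fps_map cst G"
  by (rule fps_ext) (simp add: cst_add)

lemma fock_series_mult: "fock_series (F * G) = fock_series F * fock_series G"
  unfolding fock_series_def
  by (intro fps_map_mult fps_map_cst_add cst_add cst_mult)

lemma fock_series_swap: "fps_swap (fock_series F) = fock_series (fps_swap F)"
  by (intro fps_ext) simp

section \<open>Shift automorphisms\<close>

text \<open>The homomorphism v_k(w) \<mapsto> a_k(z - w) v_k(w), written out on the coefficients of
  w; the result is a series in z. Both \<Phi>(z) and \<Psi>(z) are special cases.\<close>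

definition shift :: "(fvar_kind \<Rightarrow> complex fps) \<Rightarrow> fock \<Rightarrow> fock fps" where
  "shift a = fsubst (\<lambda>(k, m). Abs_fps (\<lambda>i. \<Sum>l\<le>m. cst (diff_coeff (a k) i l) * pvar (k, m - l)))"

definition fser :: "fvar_kind \<Rightarrow> fock fps" where
  "fser k = Abs_fps (\<lambda>m. pvar (k, m))"

lemma shift_add: "shift a (p + q) = shift a p + shift a q"
  and shift_mult: "shift a (p * q) = shift a p * shift a q"
  and shift_cst: "shift a (cst c) = fps_const (cst c)"
  by (simp_all add: shift_def fsubst_add fsubst_mult fsubst_cst)

lemma shift_var_nth:
  "fps_nth (shift a (pvar (k, m))) i = (\<Sum>l\<le>m. cst (diff_coeff (a k) i l) * pvar (k, m - l))"
  by (simp add: shift_def fsubst_var)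

lemma shift_nth_linear: "fock_linear (\<lambda>p. fps_nth (shift a p) i)"
  unfolding shift_def by (rule fsubst_nth_linear)

lemma shift_0 [simp]: "shift a 0 = 0"
  using shift_cst[of a 0] by simp

lemma shift_fixed: "a k = 1 \<Longrightarrow> shift a (pvar (k, m)) = fps_const (pvar (k, m))"
  by (rule fps_ext) (auto simp: shift_var_nth diff_coeff_1 if_distrib if_distribR sum.delta cst_1 cong: if_cong)

lemma fps_map_shift_mult: "fps_map (shift a) (F * G) = fps_map (shift a) F * fps_map (shift a) G"
  by (intro fps_map_mult shift_add shift_mult)

lemma fps_map_shift_add: "fps_map (shift a) (F + G) = fps_map (shift a) F + fps_map (shift a) G"
  by (rule fps_ext) (simp add: shift_add)

lemma fps_map_shift_const: "fps_map (shift a) (fps_const p) = fps_const (shift a p)"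
  by (rule fps_ext) simp

lemma fps_map_shift_fser:
  "fps_map (shift a) (fser k) = fock_series (diff_series (a k)) * fps_map fps_const (fser k)"
  by (intro fps_ext) (simp add: fser_def shift_var_nth fps_mult_nth fps_sum_nth atLeast0AtMost mult_delta_right)

text \<open>Both composites multiply each generating series by the same scalar factors. The swap
  only restores the order of the variables.\<close>

lemma shift_comm: "fps_map (shift a) (shift b p) = fps_swap (fps_map (shift b) (shift a p))"
proof (induction p rule: fock_induct)
  case (cst c)
  show ?case
    by (intro fps_ext) (simp add: shift_cst)
next
  case (var v p)
  obtain k m where v: "v = (k, m)" by force
  have "fps_map (shift a) (shift b (pvar (k, m))) = fps_swap (fps_map (shift b) (shift a (pvar (k, m))))"
  proof (intro fps_ext)
    fix i j :: nat
    \<comment> \<open>In either order the sum runs over all pairs with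
      \<open>l + l' \<le> m\<close>, a set that is symmetric in \<open>l\<close> and
      \<open>l'\<close>.\<close>
    have eq: "fps_nth (shift a (fps_nth (shift b (pvar (k, m))) j)) i
        = (\<Sum>(l, l')\<in>{(l, l'). l + l' \<le> m}. cst (diff_coeff (b k) j l) * cst (diff_coeff (a k) i l') * pvar (k, m - l - l'))"
      for a b i j
    proof -
      have "fps_nth (shift a (fps_nth (shift b (pvar (k, m))) j)) i
        = (\<Sum>l\<le>m. \<Sum>l'\<le>m - l. cst (diff_coeff (b k) j l) * cst (diff_coeff (a k) i l') * pvar (k, m - l - l'))"
        unfolding shift_var_nth fock_linear_sum[OF shift_nth_linear] fock_linear_cst[OF shift_nth_linear]
        by (simp add: sum_distrib_left mult.assoc)
      also have "\<dots> = (\<Sum>(l, l')\<in>(SIGMA l:{..m}. {..m - l}). cst (diff_coeff (b k) j l) * cst (diff_coeff (a k) i l') * pvar (k, m - l - l'))"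
        by (simp add: sum.Sigma)
      also have "(SIGMA l:{..m}. {..m - l}) = {(l, l'). l + l' \<le> m}"
        by auto
      finally show ?thesis .
    qed
    have "fps_nth (shift a (fps_nth (shift b (pvar (k, m))) j)) i = fps_nth (shift b (fps_nth (shift a (pvar (k, m))) i)) j"
      unfolding eq
      by (rule sum.reindex_bij_witness[where i = prod.swap and j = prod.swap])
        (auto simp: ac_simps diff_right_commute)
    then show "fps_nth (fps_nth (fps_map (shift a) (shift b (pvar (k, m)))) j) i
      = fps_nth (fps_nth (fps_swap (fps_map (shift b) (shift a (pvar (k, m))))) j) i"
      by simp
  qed
  then show ?case
    by (simp only: v shift_mult fps_map_shift_mult fps_swap_mult var)
next
  case (add p q)
  have "fps_swap (F + G) = fps_swap F + fps_swap (G :: fock fps fps)" for F G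
    by (intro fps_ext) simp
  then show ?case
    by (simp only: shift_add fps_map_shift_add add)
qed

lemma fps_diag_const: "fps_diag (fps_const F) = F"
  by (rule fps_ext) (simp add: fps_diag_def if_distrib if_distribR sum.delta cong: if_cong)

lemma fps_diag_map_const: "fps_diag (fps_map fps_const F) = F"
proof (rule fps_ext)
  fix n
  have "fps_nth (fps_diag (fps_map fps_const F)) n = (\<Sum>j\<le>n. if j = n then fps_nth F n else 0)"
    unfolding fps_diag_def by (auto intro!: sum.cong)
  then show "fps_nth (fps_diag (fps_map fps_const F)) n = fps_nth F n"
    by simp
qed

text \<open>On each kind of variable at least one of the two shifts is trivial, so at w = z their
  composite acts there as the other one. This splits the shift of \<psi>(z) into \<Phi>(z) and
  \<Psi>(z).\<close>

lemma shift_diag: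
  assumes "\<And>k. a k = 1 \<or> b k = 1"
  shows "shift (\<lambda>k. a k * b k) p = fps_diag (fps_map (shift a) (shift b p))"
proof (induction p rule: fock_induct)
  case (cst c)
  then show ?case by (simp add: shift_cst fps_map_shift_const fps_diag_const)
next
  case (var v p)
  obtain k m where v: "v = (k, m)" by force
  have "shift (\<lambda>k. a k * b k) (pvar (k, m)) = fps_diag (fps_map (shift a) (shift b (pvar (k, m))))"
  proof (cases "b k = 1")
    case True
    have "shift (\<lambda>k. a k * b k) (pvar (k, m)) = shift a (pvar (k, m))"
      using True by (intro fps_ext) (simp add: shift_var_nth)
    then show ?thesis
      using True by (simp add: shift_fixed fps_map_shift_const fps_diag_const)
  next
    case False
    then have a: "a k = 1" using assms by blast
    have "fps_map (shift a) (shift b (pvar (k, m))) = fps_map fps_const (shift b (pvar (k, m)))"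
    proof (intro fps_ext)
      fix i j :: nat
      have "fps_nth (shift a (fps_nth (shift b (pvar (k, m))) j)) i
        = (if i = 0 then fps_nth (shift b (pvar (k, m))) j else 0)"
        unfolding shift_var_nth fock_linear_sum[OF shift_nth_linear] fock_linear_cst[OF shift_nth_linear]
        by (simp add: a diff_coeff_1 if_distrib if_distribR sum.delta shift_fixed cong: if_cong)
      then show "fps_nth (fps_nth (fps_map (shift a) (shift b (pvar (k, m)))) j) i
         = fps_nth (fps_nth (fps_map fps_const (shift b (pvar (k, m)))) j) i"
        by simp
    qed
    moreover have "shift (\<lambda>k. a k * b k) (pvar (k, m)) = shift b (pvar (k, m))"
      using a by (intro fps_ext) (simp add: shift_var_nth)
    ultimately show ?thesis by (simp add: fps_diag_map_const)
  qed
  then show ?case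
    by (simp only: v shift_mult fps_map_shift_mult fps_diag_mult var)
next
  case (add p q)
  then show ?case by (simp only: shift_add fps_map_shift_add fps_diag_add)
qed

section \<open>The translation derivation\<close>

definition transl :: "fock \<Rightarrow> fock" where
  "transl = fderiv (\<lambda>(k, m). of_nat (Suc m) * pvar (k, Suc m))"

lemma transl_linear: "fock_linear transl"
  unfolding transl_def by (rule fderiv_linear)

lemma transl_cst: "transl (cst c) = 0"
  and transl_var: "transl (pvar (k, m)) = of_nat (Suc m) * pvar (k, Suc m)"
  and transl_mult: "transl (p * q) = transl p * q + p * transl q"
  by (simp_all add: transl_def fderiv_cst fderiv_var fderiv_mult)

lemma fps_map_transl_mult: "fps_map transl (F * G) = fps_map transl F * G + F * fps_map transl G"
  by (rule fps_ext)
    (simp add: fps_mult_nth fock_linear_sum[OF transl_linear] transl_mult sum.distrib)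

lemma fps_map_transl_fser: "fps_map transl (fser k) = fps_deriv (fser k)"
  by (rule fps_ext) (simp add: fser_def transl_var)

text \<open>Coefficient form of (\<partial>/\<partial>z + \<partial>/\<partial>w) a(z - w) =
  0.\<close>

lemma diff_coeff_Suc: "of_nat (Suc i) * diff_coeff a (Suc i) l = - (of_nat (Suc l) * diff_coeff a i (Suc l))"
proof -
  have "Suc i * (Suc (i + l) choose Suc i) = Suc l * (Suc (i + l) choose i)"
    using Suc_times_binomial_eq[of "i + l" i] Suc_times_binomial_eq[of "i + l" l]
      binomial_symmetric[of i "Suc (i + l)"] binomial_symmetric[of i "i + l"]
    by (simp add: Suc_diff_le mult.commute del: binomial_Suc_Suc mult_Suc mult_Suc_right)
  then have "(of_nat (Suc i) * of_nat (Suc (i + l) choose Suc i) :: complex) = of_nat (Suc l) * of_nat (Suc (i + l) choose i)"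
    by (simp only: flip: of_nat_mult)
  then have "of_nat (Suc i) * of_nat (Suc (i + l) choose Suc i) * (fps_nth a (Suc (i + l)) * (- 1) ^ l)
    = of_nat (Suc l) * of_nat (Suc (i + l) choose i) * (fps_nth a (Suc (i + l)) * (- 1) ^ l)"
    by (simp only:)
  then show ?thesis
    unfolding diff_coeff_def add_Suc add_Suc_right power_Suc by (simp only: ac_simps mult_minus_left mult_1_left mult_minus_right minus_minus)
qed

text \<open>On the generating series \<open>transl\<close> is d/dw, and the w-derivative of a(z - w)
  is minus its z-derivative. So the commutator of \<open>transl\<close> with the shift is d/dz,
  first on variables and then, by the product rule, on all polynomials.\<close>

lemma shift_transl: "fps_map transl (shift a p) = shift a (transl p) + fps_deriv (shift a p)"
proof (induction p rule: fock_induct)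
  case (cst c)
  show ?case
    by (rule fps_ext) (simp add: shift_cst transl_cst fock_linear_0[OF transl_linear])
next
  case (var v p)
  obtain k m where v: "v = (k, m)" by force
  have "fps_map transl (shift a (pvar (k, m))) = shift a (transl (pvar (k, m))) + fps_deriv (shift a (pvar (k, m)))"
  proof (rule fps_ext)
    fix i
    let ?d = "\<lambda>i l. diff_coeff (a k) i l" and ?v = "\<lambda>m. pvar (k, m)"
    have of_nat_cst: "of_nat n = cst (of_nat n)" for n
      by simp
    have "transl (fps_nth (shift a (?v m)) i) = (\<Sum>l\<le>m. cst (?d i l * of_nat (Suc m - l)) * ?v (Suc m - l))"
      unfolding shift_var_nth fock_linear_sum[OF transl_linear] fock_linear_cst[OF transl_linear] transl_var cst_mult
      by (intro sum.cong refl) (simp only: of_nat_cst Suc_diff_le mult.assoc atMost_iff)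
    \<comment> \<open>All three sums are brought to the range \<open>l \<le> Suc m\<close>, where
      their coefficients \<open>Suc m - l\<close>, \<open>Suc m\<close> and \<open>- l\<close> match
      term by term.\<close>
    also have "\<dots> = (\<Sum>l\<le>Suc m. cst (?d i l * of_nat (Suc m - l)) * ?v (Suc m - l))"
      by (simp only: sum.atMost_Suc diff_self_eq_0 of_nat_0 mult_zero_right cst_0 mult_zero_left add_0_right)
    finally have 1: "transl (fps_nth (shift a (?v m)) i)
      = (\<Sum>l\<le>Suc m. cst (?d i l * of_nat (Suc m - l)) * ?v (Suc m - l))" .
    have 2: "fps_nth (shift a (transl (?v m))) i
      = (\<Sum>l\<le>Suc m. cst (?d i l * of_nat (Suc m)) * ?v (Suc m - l))"
      unfolding transl_var of_nat_cst fock_linear_cst[OF shift_nth_linear] shift_var_nth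
      unfolding cst_mult sum_distrib_left by (intro sum.cong refl) (simp only: ac_simps)
    have "fps_nth (fps_deriv (shift a (?v m))) i
      = (\<Sum>l\<le>m. cst (of_nat (Suc i) * ?d (Suc i) l) * ?v (m - l))"
      unfolding fps_deriv_nth of_nat_cst shift_var_nth sum_distrib_left cst_mult
      by (simp only: mult.assoc Suc_eq_plus1)
    also have "\<dots> = (\<Sum>l\<le>m. cst (- (?d i (Suc l) * of_nat (Suc l))) * ?v (Suc m - Suc l))"
      unfolding diff_coeff_Suc by (simp only: mult.commute diff_Suc_Suc)
    also have "\<dots> = (\<Sum>l\<le>Suc m. cst (- (?d i l * of_nat l)) * ?v (Suc m - l))"
      unfolding sum.atMost_Suc_shift by (simp only: of_nat_0 mult_zero_right minus_zero cst_0 mult_zero_left add_0_left)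
    finally have 3: "fps_nth (fps_deriv (shift a (?v m))) i
      = (\<Sum>l\<le>Suc m. cst (- (?d i l * of_nat l)) * ?v (Suc m - l))" .
    have "cst (?d i l * of_nat (Suc m - l)) * ?v (Suc m - l)
      = cst (?d i l * of_nat (Suc m)) * ?v (Suc m - l) + cst (- (?d i l * of_nat l)) * ?v (Suc m - l)"
      if "l \<le> Suc m" for l
      unfolding distrib_right[symmetric] cst_add[symmetric] of_nat_diff[OF that] by (simp only: right_diff_distrib minus_mult_right distrib_left diff_conv_add_uminus)
    then show "fps_nth (fps_map transl (shift a (?v m))) i
      = fps_nth (shift a (transl (?v m)) + fps_deriv (shift a (?v m))) i"
      unfolding fps_map_nth fps_add_nth 1 2 3 sum.distrib[symmetric] by (intro sum.cong refl) simp
  qed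
  then show ?case
    by (simp add: v shift_mult shift_add transl_mult fps_map_transl_mult var algebra_simps)
next
  case (add p q)
  then show ?case
    by (auto simp: fps_eq_iff shift_add fock_linear_add[OF transl_linear] algebra_simps)
qed

section \<open>Dressing operators\<close>

locale twisted_fock =
  fixes q :: "complex fps"
begin

text \<open>\<open>gen_e\<close> yields \<Phi>(z), \<open>gen_f\<close> yields \<Psi>(z) and
  \<open>gen_psi\<close> their product. The sign change in q arises because \<Psi>(z) involves q(w -
  z), while \<open>shift\<close> expects a series in z - w.\<close>

definition charge :: "gen \<Rightarrow> fvar_kind \<Rightarrow> complex fps" where
  "charge g k =
    (if k = Fb \<and> g \<noteq> gen_f then q
     else if k = Fc \<and> g \<noteq> gen_e then fps_compose q (- fps_X) else 1)"

fun prefactor :: "gen \<Rightarrow> fock fps" where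
  "prefactor gen_e = fser Fb"
| "prefactor gen_f = fser Fc"
| "prefactor gen_psi = fser Fb * fser Fc"

text \<open>The scalar factor, as a series in z - w, which the shift of the first generator at z
  produces on the prefactor of the second one at w.\<close>

fun cross :: "gen \<Rightarrow> gen \<Rightarrow> complex fps" where
  "cross g gen_e = charge g Fb"
| "cross g gen_f = charge g Fc"
| "cross g gen_psi = charge g Fb * charge g Fc"

text \<open>The field of \<open>g\<close> stripped of its free field: b \<Phi>, c \<Psi> or b c
  \<Phi> \<Psi>.\<close>

definition dress :: "gen \<Rightarrow> fock \<Rightarrow> fock fps" where
  "dress g p = prefactor g * shift (charge g) p"

lemma dress_nth_linear: "fock_linear (\<lambda>p. fps_nth (dress g p) i)"
  by (auto simp: fock_linear_def dress_def shift_add shift_mult shift_cst distrib_left mult.left_commute[of "prefactor g"])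

lemma dress_0 [simp]: "dress g 0 = 0"
  by (simp add: dress_def)

lemma fps_map_const_mult: "fps_map fps_const (F * G) = fps_map fps_const F * fps_map fps_const (G :: fock fps)"
  by (rule fps_map_mult) simp_all

lemma shift_prefactor:
  "fps_map (shift (charge g)) (prefactor g')
     = fock_series (diff_series (cross g g')) * fps_map fps_const (prefactor g')"
  by (cases g') (simp_all add: fps_map_shift_fser fps_map_shift_mult fps_map_const_mult
      diff_series_mult fock_series_mult ac_simps)

lemma fps_swap_const: "fps_swap (fps_const F) = fps_map fps_const (F :: fock fps)"
  by (intro fps_ext) simp

text \<open>Moving the shift of \<open>g\<close> past the prefactor of \<open>g'\<close> collects in
  one scalar series everything that depends on the order of the two operators.\<close>

lemma fps_map_dress_dress:
  "fps_map (dress g) (dress g' p) = fps_const (prefactor g) * fock_series (diff_series (cross g g'))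
     * fps_map fps_const (prefactor g') * fps_map (shift (charge g)) (shift (charge g') p)"
proof -
  have "fps_map (dress g) F = fps_const (prefactor g) * fps_map (shift (charge g)) F" for F
    by (rule fps_ext) (simp add: dress_def)
  then show ?thesis
    by (simp add: dress_def fps_map_shift_mult shift_prefactor mult.assoc)
qed

text \<open>The two orders differ only in their scalar factors, and \<open>C\<close> carries one
  factor to the other. Exchange relations thus reduce to identities between scalar series.\<close>

lemma fps_map_dress_exchange:
  assumes "diff_series (cross g g') = C * fps_swap (diff_series (cross g' g))"
  shows "fps_map (dress g) (dress g' p) = fock_series C * fps_swap (fps_map (dress g') (dress g p))"
  unfolding fps_map_dress_dress fps_swap_mult fps_swap_const fock_series_swap assms fock_series_mult
    shift_comm[of "charge g" "charge g'"] fps_swap_swap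
  by (simp add: fps_swap_const[symmetric] ac_simps)

lemma dress_exchange:
  assumes "diff_series (cross g g') = C * fps_swap (diff_series (cross g' g))"
  shows "fps_nth (dress g (fps_nth (dress g' p) j)) i
    = (\<Sum>l\<le>j. \<Sum>k\<le>i. cst (fps_nth (fps_nth C l) k)
        * fps_nth (dress g' (fps_nth (dress g p) (i - k))) (j - l))"
  using arg_cong[OF fps_map_dress_exchange[OF assms, of p], of "\<lambda>F. fps_nth (fps_nth F j) i"]
  by (simp add: fps_nth_nth_mult)

lemma diff_series_1: "diff_series 1 = 1"
  by (intro fps_ext) (auto simp: diff_coeff_1)

lemma fps_swap_1: "fps_swap 1 = (1 :: complex fps fps)"
  by (intro fps_ext) auto

lemma cross_e_f: "diff_series (cross gen_e gen_f) = 1 * fps_swap (diff_series (cross gen_f gen_e))"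
  by (simp add: charge_def diff_series_1 fps_swap_1)

lemma dress_e_f: "fps_nth (dress gen_f (fps_nth (dress gen_e p) i)) j = fps_nth (dress gen_e (fps_nth (dress gen_f p) j)) i"
proof -
  have "fock_series 1 = 1"
    by (intro fps_ext) (auto simp: cst_1)
  then show ?thesis
    using arg_cong[OF fps_map_dress_exchange[OF cross_e_f, of p], of "\<lambda>F. fps_nth (fps_nth F j) i"]
    by simp
qed

text \<open>No scalar factor arises between the dressings of e and f, and the product of their
  shifts at w = z is the shift of \<psi>. This is how \<psi> enters the commutator of e and
  f.\<close>

lemma dress_psi: "fps_nth (dress gen_psi p) n = (\<Sum>j\<le>n. fps_nth (dress gen_e (fps_nth (dress gen_f p) j)) (n - j))"
proof -
  have "charge gen_psi = (\<lambda>k. charge gen_e k * charge gen_f k)"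
    by (auto simp: charge_def)
  moreover have "charge gen_e k = 1 \<or> charge gen_f k = 1" for k
    by (simp add: charge_def)
  ultimately have "dress gen_psi p = prefactor gen_e * prefactor gen_f
      * fps_diag (fps_map (shift (charge gen_e)) (shift (charge gen_f) p))"
    by (simp add: dress_def shift_diag)
  also have "\<dots> = fps_diag (fps_const (prefactor gen_e) * fps_map fps_const (prefactor gen_f)
      * fps_map (shift (charge gen_e)) (shift (charge gen_f) p))"
    by (simp add: fps_diag_mult fps_diag_const fps_diag_map_const)
  also have "\<dots> = fps_diag (fps_map (dress gen_e) (dress gen_f p))"
  proof -
    have "fock_series (diff_series (cross gen_e gen_f)) = 1"
      by (intro fps_ext) (auto simp: charge_def diff_coeff_1 cst_1)
    then show ?thesis
      by (simp only: fps_map_dress_dress mult_1_right)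
  qed
  finally show ?thesis
    by (simp add: fps_diag_def)
qed

text \<open>Prefactor and shift each have commutator d/dz with \<open>transl\<close>, hence so does
  their product.\<close>

lemma dress_transl: "fps_map transl (dress g p) = dress g (transl p) + fps_deriv (dress g p)"
proof -
  have "fps_map transl (prefactor g) = fps_deriv (prefactor g)"
    by (cases g) (simp_all add: fps_map_transl_fser fps_map_transl_mult algebra_simps)
  then show ?thesis
    by (simp add: dress_def fps_map_transl_mult shift_transl algebra_simps)
qed

section \<open>Free bosons\<close>

definition pdiff :: "fvar \<Rightarrow> fock \<Rightarrow> fock" where
  "pdiff v = fderiv (\<lambda>w. if w = v then 1 else 0)"

lemma pdiff_linear: "fock_linear (pdiff v)"
  unfolding pdiff_def by (rule fderiv_linear)

lemma pdiff_cst: "pdiff v (cst c) = 0"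
  and pdiff_var: "pdiff v (pvar w) = (if w = v then 1 else 0)"
  and pdiff_mult: "pdiff v (p * r) = pdiff v p * r + p * pdiff v r"
  by (simp_all add: pdiff_def fderiv_cst fderiv_var fderiv_mult)

lemma pdiff_var_mult: "pdiff v (pvar w * p) = (if w = v then p else 0) + pvar w * pdiff v p"
  by (simp add: pdiff_mult pdiff_var)

lemmas pdiff_0 = fock_linear_0[OF pdiff_linear]
lemmas pdiff_add = fock_linear_add[OF pdiff_linear]

lemma pdiff_comm: "pdiff v (pdiff w p) = pdiff w (pdiff v p)"
  by (induction p rule: fock_induct) (auto simp: pdiff_cst pdiff_0 pdiff_var_mult pdiff_add)

lemma pdiff_eq_0: "\<exists>M. \<forall>m\<ge>M. pdiff (k, m) p = 0"
proof (induction p rule: fock_induct)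
  case (var v p)
  then obtain M where "\<forall>m\<ge>M. pdiff (k, m) p = 0" by blast
  then show ?case
    by (intro exI[of _ "max M (Suc (snd v))"]) (auto simp: pdiff_var_mult)
next
  case (add p r)
  then obtain M M' where "\<forall>m\<ge>M. pdiff (k, m) p = 0" "\<forall>m\<ge>M'. pdiff (k, m) r = 0" by blast
  then show ?case
    by (intro exI[of _ "max M M'"]) (auto simp: pdiff_add)
qed (simp add: pdiff_cst)

text \<open>The shifts fix all \<open>Fx\<close> and \<open>Fy\<close> variables, and the prefactors
  contain only \<open>Fb\<close> and \<open>Fc\<close> variables.\<close>

lemma pdiff_dress:
  assumes "k = Fx \<or> k = Fy"
  shows "fps_nth (dress g (pdiff (k, m) p)) i = pdiff (k, m) (fps_nth (dress g p) i)"
proof -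
  have fps_map_mult: "fps_map (pdiff v) (F * G) = fps_map (pdiff v) F * G + F * fps_map (pdiff v) G" for v F G
    by (rule fps_ext) (simp add: fps_mult_nth fock_linear_sum[OF pdiff_linear] pdiff_mult sum.distrib)
  have charge: "charge g k = 1"
    using assms by (auto simp: charge_def)
  have "fps_map (pdiff (k, m)) (shift (charge g) p) = shift (charge g) (pdiff (k, m) p)"
  proof (induction p rule: fock_induct)
    case (cst c)
    show ?case by (rule fps_ext) (simp add: shift_cst pdiff_cst pdiff_0)
  next
    case (var v p)
    obtain k' m' where v: "v = (k', m')" by force
    have "fps_map (pdiff (k, m)) (shift (charge g) (pvar v)) = (if v = (k, m) then 1 else 0)"
    proof (cases "k' = k")
      case True
      then show ?thesis
        by (auto simp: v shift_fixed charge pdiff_var pdiff_0 intro!: fps_ext)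
    next
      case False
      then show ?thesis
        by (auto simp: v shift_var_nth fock_linear_sum[OF pdiff_linear] fock_linear_cst[OF pdiff_linear]
            pdiff_var intro!: fps_ext)
    qed
    then show ?case
      by (simp add: shift_mult fps_map_mult var pdiff_var_mult shift_add if_distrib shift_0 cong: if_cong)
  next
    case (add p r)
    then show ?case
      by (auto simp: fps_eq_iff shift_add pdiff_add)
  qed
  moreover have "fps_map (pdiff (k, m)) (fser Fb) = 0" "fps_map (pdiff (k, m)) (fser Fc) = 0"
    using assms by (auto simp: fser_def pdiff_var intro!: fps_ext)
  then have "fps_map (pdiff (k, m)) (prefactor g) = 0"
    by (cases g) (simp_all add: fps_map_mult)
  ultimately have "fps_map (pdiff (k, m)) (dress g p) = dress g (pdiff (k, m) p)"
    by (simp add: dress_def fps_map_mult)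
  then show ?thesis
    by (metis fps_map_nth)
qed

text \<open>The coefficient of \<open>z\<close> to the power \<open>- k - 1\<close> in \<beta>(z),
  in \<gamma>(z) and, for \<psi>, in the identity field, whose only coefficient sits at
  \<open>k = - 1\<close>.\<close>

fun boson :: "gen \<Rightarrow> int \<Rightarrow> fock \<Rightarrow> fock" where
  "boson gen_e k p = (if k < 0 then pvar (Fx, nat (- k - 1)) * p else pdiff (Fy, nat k) p)"
| "boson gen_f k p = (if k < 0 then pvar (Fy, nat (- k - 1)) * p else - pdiff (Fx, nat k) p)"
| "boson gen_psi k p = (if k = - 1 then p else 0)"

lemma boson_linear: "fock_linear (boson g k)"
  by (cases g) (auto simp: fock_linear_def pdiff_add fock_linear_cst[OF pdiff_linear] distrib_left mult.left_commute)

lemmas boson_0 = fock_linear_0[OF boson_linear]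

lemma boson_comm:
  assumes "g = g' \<or> g = gen_psi \<or> g' = gen_psi"
  shows "boson g k (boson g' l p) = boson g' l (boson g k p)"
  using assms
  by (cases g; cases g')
    (auto simp: pdiff_var_mult pdiff_comm fock_linear_uminus[OF pdiff_linear] pdiff_0 mult.left_commute)

text \<open>Coefficient form of [\<beta>(z), \<gamma>(w)] = z^-1 \<delta>(w/z).\<close>

lemma boson_e_f: "boson gen_e k (boson gen_f l p) = boson gen_f l (boson gen_e k p) + (if k + l = - 1 then p else 0)"
  by (auto simp: pdiff_var_mult pdiff_comm fock_linear_uminus[OF pdiff_linear] mult.left_commute)

lemma boson_finite: "\<exists>K. \<forall>k\<ge>K. boson g k p = 0"
proof -
  obtain M M' where "\<forall>m\<ge>M. pdiff (Fx, m) p = 0" "\<forall>m\<ge>M'. pdiff (Fy, m) p = 0"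
    using pdiff_eq_0 by metis
  then show ?thesis
    by (intro exI[of _ "int (max M M')"], cases g) (auto simp: nat_le_iff)
qed

text \<open>For \<open>k \<ge> - n\<close> and \<open>l \<ge> n\<close> the commutator vanishes
  since \<open>k + l \<ge> 0\<close>, so a bound for \<open>p\<close> alone works for all these
  \<open>l\<close> at once.\<close>

lemma boson_boson_finite: "\<exists>K. \<forall>k\<ge>K. \<forall>l\<ge>n. boson g k (boson g' l p) = 0"
proof -
  obtain K where K: "boson g k p = 0" if "k \<ge> K" for k
    using boson_finite by blast
  have "boson g k (boson g' l p) = 0" if "k \<ge> max K (- n)" "l \<ge> n" for k l
  proof -
    have "boson g k p = 0" using that K by simp
    moreover consider "g = g' \<or> g = gen_psi \<or> g' = gen_psi" | "g = gen_e" "g' = gen_f" | "g = gen_f" "g' = gen_e"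
      by (cases g; cases g') auto
    then have "boson g k (boson g' l p) = boson g' l (boson g k p)"
    proof cases
      case 1
      then show ?thesis by (rule boson_comm)
    next
      case 2
      then show ?thesis using boson_e_f[of k l p] that by auto
    next
      case 3
      then show ?thesis using boson_e_f[of l k p] that by auto
    qed
    ultimately show ?thesis by (simp add: boson_0)
  qed
  then show ?thesis by blast
qed

lemma dress_boson: "fps_nth (dress g (boson g' k p)) i = boson g' k (fps_nth (dress g p) i)"
proof -
  have "fps_nth (dress g (pvar (k, m) * p)) i = pvar (k, m) * fps_nth (dress g p) i" if "k = Fx \<or> k = Fy" for k m
  proof -
    have "charge g k = 1" using that by (auto simp: charge_def)
    then show ?thesis
      by (simp add: dress_def shift_mult shift_fixed mult.left_commute[of "prefactor g"])
  qed
  then show ?thesis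
    by (cases g') (auto simp: pdiff_dress fock_linear_uminus[OF dress_nth_linear])
qed

text \<open>Coefficient form of the fact that the commutator of \<open>transl\<close> with each free
  field is the z-derivative of that field.\<close>

lemma transl_boson: "transl (boson g k p) = boson g k (transl p) - of_int k * boson g (k - 1) p"
proof -
  \<comment> \<open>The commutator comes from \<open>transl\<close> sending the variable of index
    \<open>m - 1\<close> to \<open>m\<close> times that of index \<open>m\<close>. No variable is
    sent to one of index 0, whence the separate case.\<close>
  have pdiff: "transl (pdiff (K, m) p) = pdiff (K, m) (transl p) - of_nat m * (if m = 0 then 0 else pdiff (K, m - 1) p)" for K m
  proof (induction p rule: fock_induct)
    case (cst c)
    then show ?case by (simp add: pdiff_cst transl_cst fock_linear_0[OF transl_linear] pdiff_0)
  next
    case (var v p)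
    obtain k' m' where v: "v = (k', m')" by force
    have "pdiff w (transl (pvar v)) = of_nat (Suc m') * pdiff w (pvar (k', Suc m'))" for w
      using fock_linear_cst[OF pdiff_linear, of w "of_nat (Suc m')"] by (simp add: v transl_var del: of_nat_Suc)
    then have "pdiff (K, m) (transl (pvar v)) = (if m \<noteq> 0 \<and> v = (K, m - 1) then of_nat m else 0)"
      by (auto simp: v pdiff_var simp del: of_nat_Suc)
    then show ?case
      using transl_cst[of 1]
      by (auto simp: cst_1 transl_mult pdiff_mult pdiff_var fock_linear_add[OF transl_linear] pdiff_add var
          fock_linear_0[OF transl_linear] distrib_left right_diff_distrib mult.left_commute)
  next
    case (add p r)
    then show ?case
      by (cases "m = 0") (simp_all add: fock_linear_add[OF transl_linear] pdiff_add distrib_left)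
  qed
  show ?thesis
  proof (cases "k < 0")
    case True
    then obtain j where k: "k = - int (Suc j)"
      by (metis negD)
    have "nat (- k - 1) = j" "nat (- (k - 1) - 1) = Suc j" "(of_int k :: fock) = - of_nat (Suc j)"
      by (simp_all add: k)
    then show ?thesis
      using True by (cases g) (simp_all add: transl_mult transl_var fock_linear_0[OF transl_linear] mult.assoc
          del: of_nat_Suc)
  next
    case False
    then obtain j where k: "k = int j"
      by (metis nonneg_int_cases not_less)
    show ?thesis
    proof (cases j)
      case 0
      then show ?thesis
        by (cases g) (simp_all add: k pdiff fock_linear_uminus[OF transl_linear] fock_linear_0[OF transl_linear])
    next
      case (Suc j')
      have "(of_int k :: fock) = of_nat (Suc j')" "nat k = Suc j'" "nat (k - 1) = j'" "\<not> k < 0" "\<not> k - 1 < 0"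
        "k \<noteq> - 1" "k - 1 \<noteq> - 1"
        by (simp_all add: k Suc)
      then show ?thesis
        by (cases g) (simp_all add: pdiff fock_linear_uminus[OF transl_linear] fock_linear_0[OF transl_linear]
          del: of_nat_Suc)
    qed
  qed
qed

end

section \<open>Modes and their commutation relations\<close>

lemma sum_triangle:
  fixes f :: "nat \<Rightarrow> nat \<Rightarrow> 'a :: comm_monoid_add"
  assumes "\<And>k i. k + i \<ge> N \<Longrightarrow> f k i = 0"
  shows "(\<Sum>k<N. \<Sum>i<N. f k i) = (\<Sum>I<N. \<Sum>k\<le>I. f k (I - k))"
proof -
  have "(\<Sum>k<N. \<Sum>i<N. f k i) = (\<Sum>(k, i)\<in>{..<N} \<times> {..<N}. f k i)"
    by (simp add: sum.cartesian_product)
  also have "\<dots> = (\<Sum>(k, i)\<in>{(k, i). k + i < N}. f k i)"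
    by (intro sum.mono_neutral_right) (auto, metis assms not_le_imp_less)
  also have "\<dots> = (\<Sum>I<N. \<Sum>k\<le>I. f k (I - k))"
    by (rule sum.triangle_reindex)
  finally show ?thesis .
qed

context twisted_fock
begin

text \<open>The coefficient of \<open>z\<close> to the power \<open>- n - 1\<close> in the dressing
  composed with the free field: power \<open>i\<close> of the dressing meets boson index
  \<open>n + i\<close>. Only finitely many terms are nonzero, by
  \<open>boson_finite\<close>.\<close>

definition mode :: "gen \<Rightarrow> int \<Rightarrow> fock \<Rightarrow> fock" where
  "mode g n p = (\<Sum>i. fps_nth (dress g (boson g (n + int i) p)) i)"

lemma mode_eq:
  assumes "\<And>k. k \<ge> K \<Longrightarrow> boson g k p = 0" "n + int N \<ge> K"
  shows "mode g n p = (\<Sum>i<N. fps_nth (dress g (boson g (n + int i) p)) i)"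
  unfolding mode_def
proof (rule Sum_any.expand_superset)
  have "i < N" if "fps_nth (dress g (boson g (n + int i) p)) i \<noteq> 0" for i
  proof (rule ccontr)
    assume "\<not> i < N"
    then have "boson g (n + int i) p = 0"
      using assms(2) by (intro assms(1)) simp
    then show False using that by simp
  qed
  then show "{i. fps_nth (dress g (boson g (n + int i) p)) i \<noteq> 0} \<subseteq> {..<N}"
    by auto
qed simp

lemma mode_linear: "fock_linear (mode g n)"
proof -
  have cst: "mode g n (cst c * p) = cst c * mode g n p" for c p
  proof -
    obtain K where K: "boson g k p = 0" if "k \<ge> K" for k
      using boson_finite by blast
    then have "mode g n p = (\<Sum>i<nat (K - n). fps_nth (dress g (boson g (n + int i) p)) i)"
      by (intro mode_eq[where K = K]) auto
    moreover have "mode g n (cst c * p)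
        = (\<Sum>i<nat (K - n). fps_nth (dress g (boson g (n + int i) (cst c * p))) i)"
      using K by (intro mode_eq[where K = K]) (auto simp: fock_linear_cst[OF boson_linear])
    ultimately show ?thesis
      by (simp add: fock_linear_cst[OF boson_linear] fock_linear_cst[OF dress_nth_linear] sum_distrib_left)
  qed
  have add: "mode g n (p + r) = mode g n p + mode g n r" for p r
  proof -
    obtain K where K: "boson g k p = 0" if "k \<ge> K" for k
      using boson_finite by blast
    obtain K' where K': "boson g k r = 0" if "k \<ge> K'" for k
      using boson_finite by blast
    define M where "M = max K K'"
    have *: "mode g n x = (\<Sum>i<nat (M - n). fps_nth (dress g (boson g (n + int i) x)) i)"
      if "x \<in> {p, r, p + r}" for x
      using that K K' by (intro mode_eq[where K = M]) (auto simp: M_def fock_linear_add[OF boson_linear])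
    show ?thesis
      by (simp add: * fock_linear_add[OF boson_linear] fock_linear_add[OF dress_nth_linear] sum.distrib)
  qed
  show ?thesis
    by (simp add: fock_linear_def cst add)
qed

text \<open>Dressings commute with bosons, so both bosons can be moved to the right; the bounds let
  a single \<open>N\<close> truncate both sums.\<close>

lemma mode_mode_eq:
  assumes K: "\<And>k l. k \<ge> K \<Longrightarrow> l \<ge> n0 \<Longrightarrow> boson g k (boson g' l p) = 0"
    and K': "\<And>k. k \<ge> K \<Longrightarrow> boson g' k p = 0"
    and "m + int N \<ge> K" "n + int N \<ge> K" "n \<ge> n0"
  shows "mode g m (mode g' n p) = (\<Sum>i<N. \<Sum>j<N.
    fps_nth (dress g (fps_nth (dress g' (boson g (m + int i) (boson g' (n + int j) p))) j)) i)"
proof -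
  have "mode g m (mode g' n p) = (\<Sum>j<N. mode g m (fps_nth (dress g' (boson g' (n + int j) p)) j))"
    using K' assms(4) by (simp add: mode_eq[where K = K and N = N] fock_linear_sum[OF mode_linear])
  also have "\<dots> = (\<Sum>j<N. \<Sum>i<N.
    fps_nth (dress g (fps_nth (dress g' (boson g (m + int i) (boson g' (n + int j) p))) j)) i)"
    using assms by (intro sum.cong refl, subst mode_eq[where K = K and N = N]) (auto simp flip: dress_boson)
  finally show ?thesis
    by (subst sum.swap)
qed

text \<open>As the bosons commute here, the exchange happens among the dressings alone. The
  truncations at all large \<open>N\<close> stand for the infinite sum over the coefficients of
  \<open>C\<close>.\<close>

lemma mode_exchange:
  assumes C: "diff_series (cross g g') = C * fps_swap (diff_series (cross g' g))"
    and comm: "g = g' \<or> g = gen_psi \<or> g' = gen_psi"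
  shows "\<exists>N0. \<forall>N\<ge>N0. mode g m (mode g' n p)
    = (\<Sum>k<N. \<Sum>l<N. cst (fps_nth (fps_nth C l) k) * mode g' (n + int l) (mode g (m + int k) p))"
proof -
  obtain K1 where K1: "boson g k p = 0" if "k \<ge> K1" for k
    using boson_finite by blast
  obtain K2 where K2: "boson g' k p = 0" if "k \<ge> K2" for k
    using boson_finite by blast
  define K where "K = max K1 K2"
  have Kg: "boson g k p = 0" and Kg': "boson g' k p = 0" if "k \<ge> K" for k
    using that K1 K2 by (auto simp: K_def)
  have swap: "boson g k (boson g' l p) = boson g' l (boson g k p)" for k l
    using boson_comm[OF comm] .
  define N0 where "N0 = nat (K - m) + nat (K - n)"
  have "mode g m (mode g' n p)
    = (\<Sum>k<N. \<Sum>l<N. cst (fps_nth (fps_nth C l) k) * mode g' (n + int l) (mode g (m + int k) p))"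
    if N: "N \<ge> N0" for N
  proof -
    define u where "u = (\<lambda>i j. boson g (m + int i) (boson g' (n + int j) p))"
    have u0: "u i j = 0" if "i \<ge> N \<or> j \<ge> N" for i j
    proof (cases "i \<ge> N")
      case True
      then have "boson g (m + int i) p = 0"
        using N by (intro Kg) (simp add: N0_def)
      then show ?thesis by (simp add: u_def swap boson_0)
    next
      case False
      then have "boson g' (n + int j) p = 0"
        using N that by (intro Kg') (simp add: N0_def)
      then show ?thesis by (simp add: u_def boson_0)
    qed
    \<comment> \<open>With \<open>I = k + i\<close> and \<open>J = l + j\<close> the fourfold sum
      regroups into the products of \<open>dress_exchange\<close>; terms with \<open>I\<close> or
      \<open>J\<close> beyond the range vanish by \<open>u0\<close>.\<close>
    define t where "t = (\<lambda>k i l j. cst (fps_nth (fps_nth C l) k)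
      * fps_nth (dress g' (fps_nth (dress g (u (k + i) (l + j))) i)) j)"
    have t0: "t k i l j = 0" if "k + i \<ge> N \<or> l + j \<ge> N" for k i l j
      using u0[of "k + i" "l + j"] that by (simp add: t_def)
    have "mode g' (n + int l) (mode g (m + int k) p) = (\<Sum>i<N. \<Sum>j<N.
        fps_nth (dress g' (fps_nth (dress g (u (k + i) (l + j))) i)) j)" for k l
      unfolding u_def swap using N Kg Kg'
      by (subst sum.swap, subst mode_mode_eq[where K = K and n0 = "m + int k" and N = N])
        (auto simp: swap[symmetric] N0_def boson_0 ac_simps)
    then have "(\<Sum>k<N. \<Sum>l<N. cst (fps_nth (fps_nth C l) k) * mode g' (n + int l) (mode g (m + int k) p))
       = (\<Sum>k<N. \<Sum>l<N. \<Sum>i<N. \<Sum>j<N. t k i l j)"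
      by (simp add: t_def sum_distrib_left)
    also have "\<dots> = (\<Sum>k<N. \<Sum>i<N. \<Sum>l<N. \<Sum>j<N. t k i l j)"
      by (rule sum.cong[OF refl], rule sum.swap)
    also have "\<dots> = (\<Sum>k<N. \<Sum>i<N. \<Sum>J<N. \<Sum>l\<le>J. t k i l (J - l))"
      by (rule sum.cong[OF refl], rule sum.cong[OF refl], rule sum_triangle, simp add: t0)
    also have "\<dots> = (\<Sum>I<N. \<Sum>k\<le>I. \<Sum>J<N. \<Sum>l\<le>J. t k (I - k) l (J - l))"
      by (intro sum_triangle) (simp add: t0)
    also have "\<dots> = (\<Sum>I<N. \<Sum>J<N. \<Sum>k\<le>I. \<Sum>l\<le>J. t k (I - k) l (J - l))"
      by (rule sum.cong[OF refl], rule sum.swap)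
    also have "\<dots> = (\<Sum>I<N. \<Sum>J<N. fps_nth (dress g (fps_nth (dress g' (u I J)) J)) I)"
    proof (intro sum.cong refl)
      fix I J
      show "(\<Sum>k\<le>I. \<Sum>l\<le>J. t k (I - k) l (J - l)) = fps_nth (dress g (fps_nth (dress g' (u I J)) J)) I"
        unfolding dress_exchange[OF C] by (subst sum.swap) (simp add: t_def)
    qed
    also have "\<dots> = mode g m (mode g' n p)"
      unfolding u_def using N Kg Kg'
      by (subst mode_mode_eq[where K = K and n0 = n and N = N]) (auto simp: N0_def swap boson_0)
    finally show ?thesis by simp
  qed
  then show ?thesis by blast
qed

lemma mode_psi: "mode gen_psi n p = (if n < 0 then fps_nth (dress gen_psi p) (nat (- n - 1)) else 0)"
proof -
  have "mode gen_psi n p = (\<Sum>i<nat (- n). fps_nth (dress gen_psi (boson gen_psi (n + int i) p)) i)"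
    by (rule mode_eq[where K = 0]) auto
  also have "\<dots> = (\<Sum>i<nat (- n). if i = nat (- n - 1) then fps_nth (dress gen_psi p) i else 0)"
    by (intro sum.cong refl) auto
  finally show ?thesis
    by (auto simp: sum.delta)
qed

text \<open>The dressings of e and f commute, so only the boson commutator survives. It forces the
  dressing indices to add up to \<open>- (m + n) - 1\<close>, which gives the diagonal sum of
  \<open>dress_psi\<close>.\<close>

lemma mode_e_f: "mode gen_e m (mode gen_f n p) - mode gen_f n (mode gen_e m p) = mode gen_psi (m + n) p"
proof -
  obtain K1 where K1: "boson gen_e k (boson gen_f l p) = 0" if "k \<ge> K1" "l \<ge> n" for k l
    using boson_boson_finite by metis
  obtain K2 where K2: "boson gen_f k (boson gen_e l p) = 0" if "k \<ge> K2" "l \<ge> m" for k l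
    using boson_boson_finite by metis
  obtain K3 where K3: "boson gen_e k p = 0" if "k \<ge> K3" for k
    using boson_finite by metis
  obtain K4 where K4: "boson gen_f k p = 0" if "k \<ge> K4" for k
    using boson_finite by metis
  define K where "K = max (max K1 K2) (max K3 K4)"
  \<comment> \<open>If \<open>m + n < 0\<close>, the summand \<open>nat (- m - n)\<close> ensures
    \<open>M < N\<close>, so the square contains the whole diagonal
    \<open>i + j = M\<close>.\<close>
  define N where "N = nat (K - m) + nat (K - n) + nat (- m - n)"
  define M where "M = nat (- (m + n) - 1)"
  have N: "m + int N \<ge> K" "n + int N \<ge> K"
    by (simp_all add: N_def)
  have K: "boson gen_e k p = 0" "boson gen_f k p = 0" if "k \<ge> K" for k
    using that K3 K4 by (simp_all add: K_def del: boson.simps)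
  have KK: "boson gen_e k (boson gen_f l p) = 0" if "k \<ge> K" "l \<ge> n" for k l
    using that by (intro K1) (simp_all add: K_def)
  have KK': "boson gen_f k (boson gen_e l p) = 0" if "k \<ge> K" "l \<ge> m" for k l
    using that by (intro K2) (simp_all add: K_def)
  let ?A = "\<lambda>i j u. fps_nth (dress gen_e (fps_nth (dress gen_f u) j)) i"
  have e_f: "mode gen_e m (mode gen_f n p)
      = (\<Sum>i<N. \<Sum>j<N. ?A i j (boson gen_e (m + int i) (boson gen_f (n + int j) p)))"
    by (rule mode_mode_eq[OF KK K(2) N order.refl])
  have "mode gen_f n (mode gen_e m p)
      = (\<Sum>j<N. \<Sum>i<N. fps_nth (dress gen_f (fps_nth (dress gen_e
           (boson gen_f (n + int j) (boson gen_e (m + int i) p))) i)) j)"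
    by (rule mode_mode_eq[OF KK' K(1) N(2,1) order.refl])
  also have "\<dots> = (\<Sum>i<N. \<Sum>j<N. ?A i j (boson gen_f (n + int j) (boson gen_e (m + int i) p)))"
    unfolding dress_e_f by (rule sum.swap)
  finally have f_e: "mode gen_f n (mode gen_e m p) = \<dots>" .
  have "mode gen_e m (mode gen_f n p) - mode gen_f n (mode gen_e m p)
      = (\<Sum>i<N. \<Sum>j<N. if (m + int i) + (n + int j) = - 1 then ?A i j p else 0)"
    unfolding e_f f_e boson_e_f sum_subtractf[symmetric]
    by (intro sum.cong refl) (auto simp: fock_linear_add[OF dress_nth_linear] simp del: boson.simps)
  also have "\<dots> = (\<Sum>i<N. \<Sum>j<N. if m + n < 0 \<and> i + j = M then ?A i j p else 0)"
    by (intro sum.cong refl if_cong) (auto simp: M_def)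
  also have "\<dots> = mode gen_psi (m + n) p"
  proof (cases "m + n < 0")
    case True
    then have "M < N" by (auto simp: M_def N_def)
    have "(\<Sum>i<N. \<Sum>j<N. if m + n < 0 \<and> i + j = M then ?A i j p else 0)
       = (\<Sum>j<N. \<Sum>i<N. if i + j = M then ?A i j p else 0)"
      using True by (subst sum.swap) simp
    also have "\<dots> = (\<Sum>j<N. if j \<le> M then ?A (M - j) j p else 0)"
    proof (intro sum.cong refl)
      fix j
      have "(\<Sum>i<N. if i + j = M then ?A i j p else 0) = (\<Sum>i<N. if i = M - j then if j \<le> M then ?A i j p else 0 else 0)"
        by (intro sum.cong refl) auto
      then show "(\<Sum>i<N. if i + j = M then ?A i j p else 0) = (if j \<le> M then ?A (M - j) j p else 0)"
        using \<open>M < N\<close> by (auto simp: sum.delta)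
    qed
    also have "\<dots> = (\<Sum>j\<le>M. ?A (M - j) j p)"
      using \<open>M < N\<close> by (intro sum.mono_neutral_cong_right) auto
    finally show ?thesis
      using True by (simp add: mode_psi dress_psi M_def)
  qed (simp add: mode_psi)
  finally show ?thesis .
qed

text \<open>Again the commutator with the field is its z-derivative: dressing and boson contribute
  \<open>i\<close> and \<open>- (n + i)\<close> to the coefficient of \<open>A i\<close>, in total
  \<open>- n\<close>.\<close>

lemma transl_mode: "transl (mode g n p) = mode g n (transl p) - of_int n * mode g (n - 1) p"
proof -
  obtain K1 where K1: "boson g k p = 0" if "k \<ge> K1" for k
    using boson_finite by metis
  obtain K2 where K2: "boson g k (transl p) = 0" if "k \<ge> K2" for k
    using boson_finite by metis
  define K where "K = max K1 K2"
  \<comment> \<open>The successor makes \<open>A N = 0\<close>, so this bound also serves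
    \<open>mode g (n - 1)\<close> and the sum with shifted index.\<close>
  define N where "N = Suc (nat (K - n))"
  define A where "A = (\<lambda>i. fps_nth (dress g (boson g (n - 1 + int i) p)) i)"
  have K: "boson g k p = 0" "boson g k (transl p) = 0" if "k \<ge> K" for k
    using that K1 K2 by (auto simp: K_def)
  have mode: "mode g n p = (\<Sum>i<N. fps_nth (dress g (boson g (n + int i) p)) i)"
    "mode g n (transl p) = (\<Sum>i<N. fps_nth (dress g (boson g (n + int i) (transl p))) i)"
    "mode g (n - 1) p = (\<Sum>i<N. A i)"
    unfolding A_def using K by (intro mode_eq[where K = K]; auto simp: N_def)+
  have of_int: "of_int k * x = cst (of_int k) * x" for k x
    by (cases k) (simp_all add: cst_uminus cst_add cst_1 algebra_simps)
  have "transl (fps_nth (dress g (boson g (n + int i) p)) i)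
      = fps_nth (dress g (boson g (n + int i) (transl p))) i
        + (of_nat (Suc i) * A (Suc i) - of_int (n + int i) * A i)" for i
  proof -
    have "transl (fps_nth (dress g (boson g (n + int i) p)) i)
      = fps_nth (dress g (transl (boson g (n + int i) p))) i + of_nat (Suc i) * A (Suc i)"
      using arg_cong[OF dress_transl, of "\<lambda>F. fps_nth F i" g "boson g (n + int i) p"]
      by (simp add: A_def add.commute)
    also have "fps_nth (dress g (transl (boson g (n + int i) p))) i
       = fps_nth (dress g (boson g (n + int i) (transl p))) i - of_int (n + int i) * A i"
      unfolding transl_boson fock_linear_diff[OF dress_nth_linear] of_int fock_linear_cst[OF dress_nth_linear]
      by (simp add: A_def algebra_simps)
    finally show ?thesis by simp
  qed
  then have "transl (mode g n p) = mode g n (transl p)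
      + ((\<Sum>i<N. of_nat (Suc i) * A (Suc i)) - (\<Sum>i<N. of_int (n + int i) * A i))"
    by (simp add: mode fock_linear_sum[OF transl_linear] sum.distrib sum_subtractf)
  also have "(\<Sum>i<N. of_nat (Suc i) * A (Suc i)) = (\<Sum>i<N. of_nat i * A i)"
  proof -
    have "A N = 0" using K by (simp add: A_def N_def)
    have "(\<Sum>i<N. of_nat (Suc i) * A (Suc i)) = (\<Sum>i<Suc N. of_nat i * A i)"
      by (subst sum.lessThan_Suc_shift) (simp del: of_nat_Suc)
    then show ?thesis using \<open>A N = 0\<close> by simp
  qed
  also have "\<dots> - (\<Sum>i<N. of_int (n + int i) * A i) = - (of_int n * mode g (n - 1) p)"
    by (simp add: mode sum_distrib_left algebra_simps flip: sum_subtractf sum_negf)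
  finally show ?thesis by simp
qed

end

section \<open>Filtrations and leading monomials\<close>

definition weight :: "(fvar \<Rightarrow> int) \<Rightarrow> fvar multiset \<Rightarrow> int" where
  "weight \<omega> M = (\<Sum>v\<in>#M. \<omega> v)"

lemma weight_simps [simp]:
  "weight \<omega> {#} = 0" "weight \<omega> (add_mset v M) = \<omega> v + weight \<omega> M" "weight \<omega> (M + N) = weight \<omega> M + weight \<omega> N"
  by (simp_all add: weight_def)

definition filt :: "(fvar \<Rightarrow> int) \<Rightarrow> int \<Rightarrow> fock set" where
  "filt \<omega> d = {p. \<forall>M\<in>Poly_Mapping.keys p. weight \<omega> M \<le> d}"

lemma filt_0 [simp]: "0 \<in> filt \<omega> d"
  by (simp add: filt_def)

lemma filt_single: "weight \<omega> M \<le> d \<Longrightarrow> Poly_Mapping.single M c \<in> filt \<omega> d"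
  by (auto simp: filt_def)

lemma filt_mono: "p \<in> filt \<omega> d \<Longrightarrow> d \<le> e \<Longrightarrow> p \<in> filt \<omega> e"
  by (auto simp: filt_def)

lemma filt_add: "p \<in> filt \<omega> d \<Longrightarrow> r \<in> filt \<omega> d \<Longrightarrow> p + r \<in> filt \<omega> d"
  using Poly_Mapping.keys_add[of p r] by (auto simp: filt_def)

lemma filt_uminus: "p \<in> filt \<omega> d \<Longrightarrow> - p \<in> filt \<omega> d"
  by (simp add: filt_def)

lemma filt_sum: "(\<And>i. i \<in> A \<Longrightarrow> f i \<in> filt \<omega> d) \<Longrightarrow> sum f A \<in> filt \<omega> d"
  by (induction A rule: infinite_finite_induct) (simp_all add: filt_add)

lemma filt_mult: "p \<in> filt \<omega> d \<Longrightarrow> r \<in> filt \<omega> e \<Longrightarrow> p * r \<in> filt \<omega> (d + e)"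
  using Poly_Mapping.keys_mult[of p r] unfolding filt_def by (fastforce intro: add_mono)

lemma filt_cst_mult: "p \<in> filt \<omega> d \<Longrightarrow> cst c * p \<in> filt \<omega> d"
  using filt_mult[of "cst c" \<omega> 0 p d] by (simp add: filt_single)

lemma filt_var: "pvar v \<in> filt \<omega> (\<omega> v)"
  by (rule filt_single) simp

lemma filt_linear:
  assumes f: "fock_linear f" and mon: "\<And>M. f (pmon M) \<in> filt \<omega> (weight \<omega> M + e)" and p: "p \<in> filt \<omega> d"
  shows "f p \<in> filt \<omega> (d + e)"
proof -
  have "p = (\<Sum>M\<in>Poly_Mapping.keys p. cst (Poly_Mapping.lookup p M) * pmon M)"
    by (rule poly_mapping_eqI)
      (auto simp: mult_single lookup_sum lookup_single when_def not_in_keys_iff_lookup_eq_zero)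
  then have "f p = (\<Sum>M\<in>Poly_Mapping.keys p. cst (Poly_Mapping.lookup p M) * f (pmon M))"
    by (metis (no_types, lifting) fock_linear_sum[OF f] fock_linear_cst[OF f] sum.cong)
  also have "\<dots> \<in> filt \<omega> (d + e)"
  proof (intro filt_sum filt_cst_mult)
    fix M assume "M \<in> Poly_Mapping.keys p"
    then have "weight \<omega> M \<le> d" using p by (simp add: filt_def)
    then show "f (pmon M) \<in> filt \<omega> (d + e)"
      using filt_mono[OF mon] by simp
  qed
  finally show ?thesis .
qed

text \<open>A shift replaces a variable by variables of the same kind with smaller or equal
  index.\<close>

lemma filt_shift:
  assumes \<omega>: "\<And>k l m. l \<le> m \<Longrightarrow> \<omega> (k, l) \<le> \<omega> (k, m)" and p: "p \<in> filt \<omega> d"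
  shows "fps_nth (shift a p) i \<in> filt \<omega> d"
proof -
  have "fps_nth (shift a (pmon M)) i \<in> filt \<omega> (weight \<omega> M)" for M
  proof (induction M arbitrary: i)
    case empty
    show ?case
      using shift_cst[of a 1] filt_single[of \<omega> "{#}" 0 1] by simp
  next
    case (add v M)
    obtain k m where v: "v = (k, m)" by force
    have "fps_nth (shift a (pvar v)) j \<in> filt \<omega> (\<omega> v)" for j
      unfolding v shift_var_nth
      by (intro filt_sum filt_cst_mult filt_mono[OF filt_var] \<omega>) simp
    then show ?case
      unfolding mon_add_mset[of v M] shift_mult fps_mult_nth weight_simps
      by (intro filt_sum filt_mult add)
  qed
  then show ?thesis
    using filt_linear[OF shift_nth_linear[of a i], of \<omega> 0] p by simp
qed

text \<open>At z = 0 the term \<open>l = 0\<close> of a shifted variable is the variable itself, by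
  the constant term 1. The other terms have smaller index, hence strictly smaller weight.\<close>

lemma filt_shift_0:
  assumes \<omega>: "\<And>k l m. l < m \<Longrightarrow> \<omega> (k, l) < \<omega> (k, m)" and a: "\<And>k. fps_nth (a k) 0 = 1"
    and p: "p \<in> filt \<omega> d"
  shows "fps_nth (shift a p) 0 - p \<in> filt \<omega> (d - 1)"
proof -
  have \<omega>': "\<omega> (k, l) \<le> \<omega> (k, m)" if "l \<le> m" for k l m
    using \<omega>[of l m k] that by (cases "l = m") auto
  have "fps_nth (shift a (pmon M)) 0 - pmon M \<in> filt \<omega> (weight \<omega> M - 1)" for M
  proof (induction M)
    case empty
    show ?case
      using shift_cst[of a 1] by simp
  next
    case (add v M)
    obtain k m where v: "v = (k, m)" by force
    have "fps_nth (shift a (pvar v)) 0 - pvar v = (\<Sum>l\<in>{1..m}. cst (diff_coeff (a k) 0 l) * pvar (k, m - l))"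
      unfolding v shift_var_nth atMost_atLeast0
      by (simp add: sum.atLeast_Suc_atMost[of 0] diff_coeff_def a cst_1)
    also have "\<dots> \<in> filt \<omega> (\<omega> v - 1)"
    proof (intro filt_sum filt_cst_mult filt_mono[OF filt_var])
      fix l assume "l \<in> {1..m}"
      then show "\<omega> (k, m - l) \<le> \<omega> v - 1" using \<omega>[of "m - l" m k] by (simp add: v)
    qed
    finally have "(fps_nth (shift a (pvar v)) 0 - pvar v) * fps_nth (shift a (pmon M)) 0
        \<in> filt \<omega> (\<omega> v - 1 + weight \<omega> M)"
      by (intro filt_mult filt_shift \<omega>' filt_single) auto
    moreover have "pvar v * (fps_nth (shift a (pmon M)) 0 - pmon M) \<in> filt \<omega> (\<omega> v + (weight \<omega> M - 1))"
      by (intro filt_mult filt_var add)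
    ultimately have "(fps_nth (shift a (pvar v)) 0 - pvar v) * fps_nth (shift a (pmon M)) 0
        + pvar v * (fps_nth (shift a (pmon M)) 0 - pmon M) \<in> filt \<omega> (weight \<omega> (add_mset v M) - 1)"
      by (intro filt_add) (simp_all add: algebra_simps)
    also have "(fps_nth (shift a (pvar v)) 0 - pvar v) * fps_nth (shift a (pmon M)) 0
        + pvar v * (fps_nth (shift a (pmon M)) 0 - pmon M)
      = fps_nth (shift a (pmon (add_mset v M))) 0 - pmon (add_mset v M)"
      unfolding mon_add_mset[of v M] shift_mult fps_mult_nth_0 by (simp add: algebra_simps)
    finally show ?case .
  qed
  moreover have "fock_linear (\<lambda>p. fps_nth (shift a p) 0 - p)"
    using shift_nth_linear[of a 0] by (simp add: fock_linear_def right_diff_distrib)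
  ultimately show ?thesis
    using filt_linear[of "\<lambda>p. fps_nth (shift a p) 0 - p" \<omega> "- 1"] p by simp
qed

section \<open>Filtration bounds for the operators\<close>

context twisted_fock
begin

lemma filt_pdiff:
  assumes "p \<in> filt \<omega> d"
  shows "pdiff v p \<in> filt \<omega> (d - \<omega> v)"
proof -
  have "pdiff v (pmon M) \<in> filt \<omega> (weight \<omega> M + - \<omega> v)" for M
  proof (induction M)
    case (add w M)
    have "pvar w * pdiff v (pmon M) \<in> filt \<omega> (\<omega> w + (weight \<omega> M + - \<omega> v))"
      by (intro filt_mult filt_var add)
    moreover have "pmon M \<in> filt \<omega> (weight \<omega> M)"
      by (simp add: filt_single)
    ultimately show ?case
      unfolding mon_add_mset[of w M] pdiff_var_mult by (auto intro!: filt_add simp: add_diff_eq)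
  qed (use pdiff_cst[of v 1] in simp)
  then show ?thesis
    using filt_linear[OF pdiff_linear[of v], of \<omega> "- \<omega> v"] assms by simp
qed

text \<open>Shifts add no weight, so the growth in \<open>i\<close> comes from the prefactor, with
  slope \<open>c\<close> and offset \<open>s\<close>.\<close>

lemma filt_dress:
  assumes \<omega>: "\<And>k l m. l \<le> m \<Longrightarrow> \<omega> (k, l) \<le> \<omega> (k, m)"
    and pre: "\<And>i. fps_nth (prefactor g) i \<in> filt \<omega> (c * int i + s)" and c: "c \<ge> 0"
    and p: "p \<in> filt \<omega> d"
  shows "fps_nth (dress g p) i \<in> filt \<omega> (d + c * int i + s)"
  unfolding dress_def fps_mult_nth
proof (rule filt_sum)
  fix j assume "j \<in> {0..i}"
  then have "c * int j \<le> c * int i"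
    using c by (simp add: mult_left_mono)
  moreover have "fps_nth (prefactor g) j * fps_nth (shift (charge g) p) (i - j) \<in> filt \<omega> (c * int j + s + d)"
    by (intro filt_mult pre filt_shift \<omega> p)
  ultimately show "fps_nth (prefactor g) j * fps_nth (shift (charge g) p) (i - j) \<in> filt \<omega> (d + c * int i + s)"
    by (rule_tac filt_mono) auto
qed

text \<open>The grading of the Fock space for which \<open>mode g n\<close> has degree at most \<open>- n\<close>.\<close>

fun deg_var :: "fvar \<Rightarrow> int" where
  "deg_var (Fb, m) = int m + 1"
| "deg_var (Fc, m) = int m"
| "deg_var (Fx, m) = int m"
| "deg_var (Fy, m) = int m + 1"

lemma filt_deg_negative: "d < 0 \<Longrightarrow> p \<in> filt deg_var d \<Longrightarrow> p = 0"
proof -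
  have nonneg: "weight deg_var M \<ge> 0" for M
  proof (induction M)
    case (add v M)
    have "deg_var v \<ge> 0" by (cases v rule: deg_var.cases) auto
    with add show ?case by simp
  qed simp
  assume "d < 0" "p \<in> filt deg_var d"
  then have "M \<notin> Poly_Mapping.keys p" for M
    using nonneg[of M] by (auto simp: filt_def)
  then have "Poly_Mapping.keys p = {}"
    by blast
  then show "p = 0" by simp
qed

lemma deg_var_mono: "l \<le> m \<Longrightarrow> deg_var (k, l) \<le> deg_var (k, m)"
  by (cases k) auto

lemma filt_deg_mode:
  assumes p: "p \<in> filt deg_var d"
  shows "mode g n p \<in> filt deg_var (d - n)"
proof -
  \<comment> \<open>The offset cancels: the dressing adds at most \<open>i + s\<close> to the
    degree, the boson of index \<open>n + i\<close> at most \<open>- (n + i) - s\<close>.\<close>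
  define s :: int where "s = (if g = gen_f then 0 else 1)"
  have pre: "fps_nth (prefactor g) i \<in> filt deg_var (1 * int i + s)" for i
  proof (cases g)
    case gen_psi
    have "fps_nth (fser Fb) j * fps_nth (fser Fc) (i - j) \<in> filt deg_var (1 * int i + s)" if "j \<in> {0..i}" for j
      using filt_mult[OF filt_var[of "(Fb, j)" deg_var] filt_var[of "(Fc, i - j)" deg_var]] that
      by (simp add: fser_def s_def gen_psi of_nat_diff add.commute)
    then show ?thesis
      unfolding gen_psi prefactor.simps fps_mult_nth by (rule filt_sum)
  qed (use filt_var[of "(Fb, i)" deg_var] filt_var[of "(Fc, i)" deg_var] in \<open>simp_all add: fser_def s_def\<close>)
  have boson: "boson g k p \<in> filt deg_var (d - k - s)" for k
    using filt_pdiff[OF p, of "(Fx, nat k)"] filt_pdiff[OF p, of "(Fy, nat k)"]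
      filt_mult[OF filt_var p, of "(Fx, nat (- k - 1))"] filt_mult[OF filt_var p, of "(Fy, nat (- k - 1))"] p
    by (cases g) (auto simp: s_def filt_uminus algebra_simps)
  obtain K where K: "boson g k p = 0" if "k \<ge> K" for k
    using boson_finite by metis
  have "mode g n p = (\<Sum>i<nat (K - n). fps_nth (dress g (boson g (n + int i) p)) i)"
    using K by (intro mode_eq[where K = K]) (auto simp del: boson.simps)
  also have "\<dots> \<in> filt deg_var (d - n)"
  proof (rule filt_sum)
    fix i
    show "fps_nth (dress g (boson g (n + int i) p)) i \<in> filt deg_var (d - n)"
      using filt_dress[OF deg_var_mono pre _ boson[of "n + int i"], of i] by (simp add: algebra_simps)
  qed
  finally show ?thesis .
qed

text \<open>
  Weights for which \<open>mode g (- m)\<close> with \<open>m \<ge> 1\<close> multiplies the leading monomial by a single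
  monomial of degree two, namely \<open>b\<^sub>0 x\<^sub>m\<^sub>-\<^sub>1\<close>, \<open>c\<^sub>0 y\<^sub>m\<^sub>-\<^sub>1\<close> or \<open>b\<^sub>0 c\<^sub>m\<^sub>-\<^sub>1\<close>.
\<close>

fun lead_var :: "fvar \<Rightarrow> int" where
  "lead_var (Fb, m) = int m"
| "lead_var (Fc, m) = 2 * int m"
| "lead_var (Fx, m) = 3 * int m + 2"
| "lead_var (Fy, m) = 3 * int m + 2"

lemma lead_var_strict_mono: "l < m \<Longrightarrow> lead_var (k, l) < lead_var (k, m)"
  by (cases k) auto

lemma lead_var_mono: "l \<le> m \<Longrightarrow> lead_var (k, l) \<le> lead_var (k, m)"
  by (cases k) auto

definition leads :: "fvar multiset \<Rightarrow> fock \<Rightarrow> bool" where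
  "leads M p \<longleftrightarrow> p - pmon M \<in> filt lead_var (weight lead_var M - 1)"

lemma leads_filt: "leads M p \<Longrightarrow> p \<in> filt lead_var (weight lead_var M)"
  using filt_add[OF filt_mono filt_single, of "p - pmon M" lead_var "weight lead_var M - 1" "weight lead_var M" M 1]
  by (simp add: leads_def)

fun lead_factor :: "gen \<Rightarrow> nat \<Rightarrow> fvar multiset" where
  "lead_factor gen_e m = {#(Fb, 0), (Fx, m - 1)#}"
| "lead_factor gen_f m = {#(Fc, 0), (Fy, m - 1)#}"
| "lead_factor gen_psi m = {#(Fb, 0), (Fc, m - 1)#}"

lemma leads_mult:
  assumes "leads M p" "r - pmon N \<in> filt lead_var (weight lead_var N - 1)"
  shows "leads (N + M) (r * p)"
proof -
  have "(r - pmon N) * p \<in> filt lead_var (weight lead_var N - 1 + weight lead_var M)"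
    by (intro filt_mult assms leads_filt)
  moreover have "pmon N * (p - pmon M) \<in> filt lead_var (weight lead_var N + (weight lead_var M - 1))"
    using assms(1) by (intro filt_mult filt_single) (auto simp: leads_def)
  ultimately have "(r - pmon N) * p + pmon N * (p - pmon M) \<in> filt lead_var (weight lead_var (N + M) - 1)"
    by (intro filt_add) (simp_all add: algebra_simps)
  also have "(r - pmon N) * p + pmon N * (p - pmon M) = r * p - pmon (N + M)"
    by (simp add: left_diff_distrib right_diff_distrib mult_single)
  finally show ?thesis
    unfolding leads_def .
qed

lemma leads_add:
  assumes "leads M p" "r \<in> filt lead_var (weight lead_var M - 1)"
  shows "leads M (p + r)"
  using filt_add[OF assms(1)[unfolded leads_def] assms(2)] by (simp add: leads_def algebra_simps)

end

locale normalized_twisted_fock = twisted_fock +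
  assumes q_0: "fps_nth q 0 = 1"
begin

lemma charge_0: "fps_nth (charge g k) 0 = 1"
  by (simp add: charge_def q_0 fps_compose_uminus')

lemma leads_shift_0:
  assumes "leads M p" shows "leads M (fps_nth (shift (charge g) p) 0)"
  using leads_add[OF assms filt_shift_0[OF lead_var_strict_mono charge_0[of g] leads_filt[OF assms]]]
  by simp

text \<open>The slopes 1, 2, 3 of \<open>lead_var\<close> on b, on c, and on x and y decide. In b(z)
  c(z) the weight is largest with the whole index on c; in the fields of e and f it is largest with
  the whole index on x or y.\<close>

lemma leads_mode:
  assumes M: "leads M p" and m: "m \<ge> 1"
  shows "leads (lead_factor g m + M) (mode g (- int m) p)"
proof (cases "g = gen_psi")
  case True
  obtain m' where m': "m = Suc m'" using m by (cases m) auto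
  let ?P = "prefactor gen_psi" and ?s = "shift (charge gen_psi) p"
  \<comment> \<open>The weight \<open>2 * j - i\<close> is largest at \<open>i = 0\<close> only,
    that is, for the monomial b_0 c_j.\<close>
  have filt: "fps_nth (fser Fb) i * fps_nth (fser Fc) (j - i) \<in> filt lead_var (2 * int j - int i)" if "i \<le> j" for i j
    using filt_mult[OF filt_var[of "(Fb, i)" lead_var] filt_var[of "(Fc, j - i)" lead_var]] that
    by (simp add: fser_def of_nat_diff algebra_simps)
  have P: "fps_nth ?P j \<in> filt lead_var (2 * int j)" for j
    unfolding prefactor.simps fps_mult_nth
    by (intro filt_sum filt_mono[OF filt]) auto
  have "fps_nth ?P m' - pmon (lead_factor gen_psi m) = (\<Sum>i\<in>{1..m'}. fps_nth (fser Fb) i * fps_nth (fser Fc) (m' - i))"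
    by (simp add: fps_mult_nth sum.atLeast_Suc_atMost[of 0] fser_def m' mult_single add_mset_commute)
  also have "\<dots> \<in> filt lead_var (weight lead_var (lead_factor gen_psi m) - 1)"
    by (intro filt_sum filt_mono[OF filt]) (auto simp: m')
  finally have "leads (lead_factor gen_psi m + M) (fps_nth ?P m' * fps_nth ?s 0)"
    by (intro leads_mult leads_shift_0 M)
  moreover have "(\<Sum>j<m'. fps_nth ?P j * fps_nth ?s (m' - j))
      \<in> filt lead_var (weight lead_var (lead_factor gen_psi m + M) - 1)"
  proof (rule filt_sum)
    fix j assume "j \<in> {..<m'}"
    moreover have "fps_nth ?P j * fps_nth ?s (m' - j) \<in> filt lead_var (2 * int j + weight lead_var M)"
      by (intro filt_mult P filt_shift lead_var_mono leads_filt M)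
    ultimately show "fps_nth ?P j * fps_nth ?s (m' - j)
        \<in> filt lead_var (weight lead_var (lead_factor gen_psi m + M) - 1)"
      by (rule_tac filt_mono) (auto simp: m')
  qed
  ultimately have "leads (lead_factor gen_psi m + M)
      (fps_nth ?P m' * fps_nth ?s 0 + (\<Sum>j<m'. fps_nth ?P j * fps_nth ?s (m' - j)))"
    by (rule leads_add)
  also have "fps_nth ?P m' * fps_nth ?s 0 + (\<Sum>j<m'. fps_nth ?P j * fps_nth ?s (m' - j)) = mode g (- int m) p"
    by (simp add: True mode_psi dress_def fps_mult_nth m' atLeast0AtMost flip: lessThan_Suc_atMost)
  finally show ?thesis by (simp add: True)
next
  case False
  define c :: int where "c = (if g = gen_e then 1 else 2)"
  let ?x = "if g = gen_e then pvar (Fx, m - 1) else pvar (Fy, m - 1)"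
  let ?b = "if g = gen_e then pvar (Fb, 0) else pvar (Fc, 0)"
  let ?w = "weight lead_var M"
  have pre: "fps_nth (prefactor g) i \<in> filt lead_var (c * int i + 0)" for i
    using filt_var[of "(Fb, i)" lead_var] filt_var[of "(Fc, i)" lead_var] False
    by (cases g) (simp_all add: fser_def c_def)
  have p: "p \<in> filt lead_var ?w"
    by (rule leads_filt[OF M])
  have boson: "boson g k p \<in> filt lead_var (?w - 3 * k - 1)" for k
  proof -
    have "pdiff (Fx, nat k) p \<in> filt lead_var (?w - 3 * k - 1)" "pdiff (Fy, nat k) p \<in> filt lead_var (?w - 3 * k - 1)" if "k \<ge> 0"
      using that by (auto intro!: filt_mono[OF filt_pdiff[OF p]])
    then show ?thesis
      using False filt_mult[OF filt_var p, of "(Fx, nat (- k - 1))"] filt_mult[OF filt_var p, of "(Fy, nat (- k - 1))"]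
      by (cases g) (auto simp: filt_uminus algebra_simps)
  qed
  obtain K where K: "boson g k p = 0" if "k \<ge> K" for k
    using boson_finite by metis
  define N where "N = nat (K + int m)"
  \<comment> \<open>Term \<open>i\<close> raises the weight by at most
    \<open>3 * m - 1 - (3 - c) * i\<close>. Since \<open>c \<le> 2\<close>, the terms with
    \<open>i > 0\<close> stay strictly below the leading weight.\<close>
  have "mode g (- int m) p = (\<Sum>i<Suc N. fps_nth (dress g (boson g (- int m + int i) p)) i)"
    using K by (intro mode_eq[where K = K]) (auto simp: N_def simp del: boson.simps)
  also have "\<dots> = fps_nth (dress g (boson g (- int m) p)) 0
      + (\<Sum>i<N. fps_nth (dress g (boson g (- int m + int (Suc i)) p)) (Suc i))"
    by (subst sum.lessThan_Suc_shift) (simp del: boson.simps)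
  also have "fps_nth (dress g (boson g (- int m) p)) 0 = (?x * ?b) * fps_nth (shift (charge g) p) 0"
  proof -
    have "nat (int m - 1) = m - 1" by simp
    then have "boson g (- int m) p = ?x * p"
      using m False by (cases g) auto
    moreover have "shift (charge g) (?x * p) = fps_const ?x * shift (charge g) p"
      by (simp add: shift_mult shift_fixed charge_def)
    ultimately show ?thesis
      using False by (cases g) (auto simp: dress_def fser_def mult.left_commute)
  qed
  finally have mode: "mode g (- int m) p = (?x * ?b) * fps_nth (shift (charge g) p) 0
      + (\<Sum>i<N. fps_nth (dress g (boson g (- int m + int (Suc i)) p)) (Suc i))" .
  have "leads (lead_factor g m + M) ((?x * ?b) * fps_nth (shift (charge g) p) 0)"
    using False by (intro leads_mult leads_shift_0 M; cases g) (simp_all add: mult_single add_mset_commute)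
  moreover have "(\<Sum>i<N. fps_nth (dress g (boson g (- int m + int (Suc i)) p)) (Suc i))
      \<in> filt lead_var (weight lead_var (lead_factor g m + M) - 1)"
  proof (rule filt_sum)
    fix i
    have "fps_nth (dress g (boson g (- int m + int (Suc i)) p)) (Suc i)
        \<in> filt lead_var (?w - 3 * (- int m + int (Suc i)) - 1 + c * int (Suc i) + 0)"
      by (intro filt_dress lead_var_mono pre boson) (simp_all add: c_def)
    then show "fps_nth (dress g (boson g (- int m + int (Suc i)) p)) (Suc i)
        \<in> filt lead_var (weight lead_var (lead_factor g m + M) - 1)"
      using False m by (elim filt_mono; cases g) (simp_all add: c_def of_nat_diff)
  qed
  ultimately show ?thesis
    unfolding mode by (rule leads_add)
qed

end

section \<open>The action of the tensor algebra on the Fock space\<close>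

abbreviation wtens :: "(gen \<times> int) list \<Rightarrow> tens" where
  "wtens l \<equiv> Poly_Mapping.single (Word l) 1"

lemma single_word: "Poly_Mapping.single w c = tscale c (wtens (letters w))"
  by (simp add: tscale_single)

lemma wtens_append: "wtens (k @ l) = wtens k * wtens l"
  by (simp add: mult_single plus_word_def)

lemma wtens_Nil: "wtens [] = 1"
  by (simp flip: zero_word_def)

context twisted_fock
begin

definition word_op :: "(gen \<times> int) list \<Rightarrow> fock \<Rightarrow> fock" where
  "word_op l = foldr (\<lambda>(g, n). mode g n) l"

lemma word_op_simps [simp]:
  "word_op [] p = p" "word_op ((g, n) # l) p = mode g n (word_op l p)" "word_op (k @ l) p = word_op k (word_op l p)"
  by (simp_all add: word_op_def)

lemma word_op_linear: "fock_linear (word_op l)"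
  by (induction l) (auto simp: fock_linear_def fock_linear_add[OF mode_linear] fock_linear_cst[OF mode_linear])

definition act :: "tens \<Rightarrow> fock \<Rightarrow> fock" where
  "act x p = (\<Sum>w\<in>Poly_Mapping.keys x. cst (Poly_Mapping.lookup x w) * word_op (letters w) p)"

lemma act_superset:
  assumes "finite A" "Poly_Mapping.keys x \<subseteq> A"
  shows "act x p = (\<Sum>w\<in>A. cst (Poly_Mapping.lookup x w) * word_op (letters w) p)"
  unfolding act_def using assms
  by (intro sum.mono_neutral_left) (auto simp: not_in_keys_iff_lookup_eq_zero)

lemma act_add: "act (x + y) p = act x p + act y p"
proof -
  let ?A = "Poly_Mapping.keys x \<union> Poly_Mapping.keys y"
  have "Poly_Mapping.keys (x + y) \<subseteq> ?A"
    by (rule Poly_Mapping.keys_add)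
  then show ?thesis
    using act_superset[of ?A x p] act_superset[of ?A y p] act_superset[of ?A "x + y" p]
    by (simp add: lookup_add cst_add sum.distrib distrib_right)
qed

lemma act_single: "act (Poly_Mapping.single w c) p = cst c * word_op (letters w) p"
  using act_superset[of "{w}" "Poly_Mapping.single w c" p] by (simp split: if_splits)

lemma act_0 [simp]: "act 0 p = 0"
  by (simp add: act_def)

lemma act_linear: "fock_linear (act x)"
  by (induction x rule: tens_induct)
    (auto simp: fock_linear_def act_single act_add fock_linear_add[OF word_op_linear]
      fock_linear_cst[OF word_op_linear] distrib_left mult.left_commute)

lemma act_mult: "act (x * y) p = act x (act y p)"
proof (induction x rule: tens_induct)
  case (single v b)
  show ?case
  proof (induction y rule: tens_induct)
    case (single w c)
    then show ?case
      unfolding mult_single act_single plus_word_def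
      by (simp add: fock_linear_cst[OF word_op_linear] cst_mult mult.assoc)
  qed (simp_all add: distrib_left act_add fock_linear_0[OF act_linear] fock_linear_add[OF act_linear])
qed (simp_all add: distrib_right act_add)

lemma act_tscale: "act (tscale c x) p = cst c * act x p"
  by (induction x rule: tens_induct)
    (simp_all add: act_add act_single tscale_single T.scale_right_distrib distrib_left cst_mult mult.assoc)

lemma act_diff: "act (x - y) p = act x p - act y p"
  using act_add[of "x - y" y p] by simp

text \<open>\<open>transl\<close> implements the derivation d of the tensor algebra; on a single
  letter this is \<open>transl_mode\<close>.\<close>

lemma transl_act: "transl (act x p) = act (tderiv x) p + act x (transl p)"
proof (induction x rule: tens_induct)
  case zero
  then show ?case by (simp add: fock_linear_0[OF transl_linear] tderiv_def)
next
  case (single w c)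
  have "transl (word_op l p) = act (deriv_letters l) p + word_op l (transl p)" for l
  proof (induction l)
    case (Cons a l)
    obtain g n where a: "a = (g, n)" by force
    show ?case
      by (simp add: a transl_mode Cons fock_linear_add[OF mode_linear] act_add act_mult act_single cst_uminus)
  qed simp
  then show ?case
    by (simp add: act_single tderiv_single act_tscale fock_linear_cst[OF transl_linear] distrib_left)
next
  case (add x y)
  then show ?case
    by (simp add: act_add tderiv_add fock_linear_add[OF transl_linear])
qed

abbreviation fock_vac :: fock where
  "fock_vac \<equiv> 1"

text \<open>A word maps 1 to a polynomial of degree at most the degree of the word, and a negative
  bound leaves only 0.\<close>

lemma act_neg_vac: "y \<in> tens_neg \<Longrightarrow> act y fock_vac = 0"
  unfolding tens_neg_def
proof (induction y rule: T.span_induct_alt)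
  case (step c x y)
  have "word_op l 1 \<in> filt deg_var (word_deg (Word l))" for l
  proof (induction l)
    case Nil
    show ?case using filt_single[of deg_var "{#}" 0 1] by (simp add: word_deg_def)
  next
    case (Cons a l)
    obtain g n where a: "a = (g, n)" by force
    show ?case
      using filt_deg_mode[OF Cons, of g n] by (simp add: a word_deg_def)
  qed
  then have *: "word_op (letters w) 1 = 0" if "word_deg w < 0" for w
    using that by (metis filt_deg_negative word.collapse)
  obtain n where "n \<ge> 1" "x \<in> tens_deg (- n)" using step by auto
  then have "word_op (letters w) 1 = 0" if "w \<in> Poly_Mapping.keys x" for w
    using that by (intro *) (force simp: tens_deg_def)
  then have "act x 1 = 0"
    by (simp add: act_def)
  then show ?case
    by (simp add: act_add act_tscale step)
qed simp

text \<open>Since \<open>transl\<close> kills 1, applying \<open>(tderiv ^^ k) a\<close> to 1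
  amounts to applying \<open>transl\<close> \<open>k\<close> times to the action of \<open>a\<close>
  on 1, which is 0.\<close>

lemma act_J_vac: "y \<in> tens_J \<Longrightarrow> act y fock_vac = 0"
  unfolding tens_J_def
proof (induction y rule: T.span_induct_alt)
  case (step c x y)
  then obtain z k a where x: "x = z * (tderiv ^^ k) a" and a: "a \<in> tens_neg"
    by auto
  have "transl 1 = 0"
    using transl_cst[of 1] by simp
  then have "act ((tderiv ^^ k) a) 1 = 0"
  proof (induction k)
    case (Suc k)
    then show ?case
      using transl_act[of "(tderiv ^^ k) a" 1]
      by (simp add: fock_linear_0[OF transl_linear] fock_linear_0[OF act_linear])
  qed (use act_neg_vac[OF a] in simp)
  then show ?case
    by (simp add: act_add act_tscale step x act_mult fock_linear_0[OF act_linear])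
qed simp

section \<open>The map from V_T to the Fock space\<close>

definition realize :: "VT \<Rightarrow> fock" where
  "realize v = act (rep_VT v) fock_vac"

text \<open>Two representatives differ by an element of \<open>tens_J\<close>, which kills the
  vacuum.\<close>

lemma realize_abs: "realize (abs_VT x) = act x fock_vac"
proof -
  have "rep_VT (abs_VT x) - x \<in> tens_J"
    using Quotient_rep_abs_fold_unmap[OF Quotient_VT] Quotient_VT
    by (metis Quotient_rep_abs Quotient_refl1 VT.abs_eq_iff VT_equivp equivp_reflp)
  from act_J_vac[OF this] show ?thesis
    by (simp add: realize_def act_diff)
qed

lemma VT_cases: obtains x where "v = abs_VT x"
  using Quotient_abs_rep[OF Quotient_VT] by metis

lemma realize_add: "realize (v + w) = realize v + realize w"
  by (cases v rule: VT_cases, cases w rule: VT_cases) (simp add: plus_VT.abs_eq realize_abs act_add)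

lemma realize_scale: "realize (vt_scale c v) = cst c * realize v"
  by (cases v rule: VT_cases) (simp add: vt_scale.abs_eq realize_abs act_tscale)

lemma realize_act: "realize (vt_act x v) = act x (realize v)"
  by (cases v rule: VT_cases) (simp add: vt_act.abs_eq realize_abs act_mult)

lemma realize_vac: "realize vt_vac = fock_vac"
  using act_single[of "Word []" 1 1, unfolded wtens_Nil] by (simp add: vt_vac_def realize_abs)

lemma realize_0: "realize 0 = 0"
  using realize_add[of 0 0] by simp

lemma realize_diff: "realize (v - w) = realize v - realize w"
  using realize_add[of "v - w" w] by simp

lemma realize_sum: "realize (sum f A) = (\<Sum>i\<in>A. realize (f i))"
  by (induction A rule: infinite_finite_induct) (simp_all add: realize_0 realize_add)

lemma act_tmode: "act (tmode (U_basis g) n) p = mode g n p"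
  by (simp add: tmode_U_basis act_single cst_1)

lemma realize_exchange:
  assumes C: "diff_series (cross a b) = C * fps_swap (diff_series (cross b a))"
    and c: "\<And>i j. c i j = fps_nth (fps_nth C j) i"
    and comm: "a = b \<or> a = gen_psi \<or> b = gen_psi"
  shows "realize (exchange c a b m n v) = 0"
proof -
  let ?f = "\<lambda>(i, j). vt_scale (c i j)
    (vt_act (tmode (U_basis b) (n + int j) * tmode (U_basis a) (m + int i)) v)"
  let ?S = "{(i, j). vt_scale (c i j)
    (vt_act (tmode (U_basis b) (n + int j) * tmode (U_basis a) (m + int i)) v) \<noteq> 0}"
  obtain N0 where N0: "mode a m (mode b n (realize v)) = (\<Sum>k<N. \<Sum>l<N.
      cst (fps_nth (fps_nth C l) k) * mode b (n + int l) (mode a (m + int k) (realize v)))" if "N \<ge> N0" for N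
    using mode_exchange[OF C comm, of m n "realize v"] by blast
  have fin: "finite ?S" by (rule finite_exchange)
  \<comment> \<open>\<open>N\<close> is at least the bound from \<open>mode_exchange\<close> and
    exceeds every index in the support of the infinite sum of \<open>exchange\<close>, so both
    become the same finite sum.\<close>
  define N where "N = Max (insert N0 (Suc ` fst ` ?S \<union> Suc ` snd ` ?S))"
  have le: "N0 \<le> N" "\<And>s. s \<in> ?S \<Longrightarrow> Suc (fst s) \<le> N" "\<And>s. s \<in> ?S \<Longrightarrow> Suc (snd s) \<le> N"
    unfolding N_def using fin by (auto intro!: Max_ge)
  have "Sum_any ?f = sum ?f ({..<N} \<times> {..<N})"
  proof (rule Sum_any.expand_superset)
    show "{s. ?f s \<noteq> 0} \<subseteq> {..<N} \<times> {..<N}"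
      using le(2,3) by (fastforce simp: Suc_le_eq)
  qed simp
  then have "realize (Sum_any ?f) = (\<Sum>k<N. \<Sum>l<N.
      cst (fps_nth (fps_nth C l) k) * mode b (n + int l) (mode a (m + int k) (realize v)))"
    by (simp add: realize_sum realize_scale realize_act act_mult act_tmode c split_def sum.cartesian_product)
  then show ?thesis
    unfolding exchange_def realize_diff
    by (simp add: N0[OF le(1)] realize_act act_mult act_tmode)
qed

end

context normalized_twisted_fock
begin

lemma realize_relators:
  assumes h: "h = fps_compose q (- fps_X) * inverse q" and r: "r \<in> relators h"
  shows "realize r = 0"
proof -
  let ?q' = "fps_compose q (- fps_X)"
  have hq: "h * q = ?q'"
    using q_0 by (simp add: h mult.assoc inverse_mult_eq_1)
  have swap_q': "fps_swap (diff_series ?q') = diff_series q"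
    by (metis fps_swap_diff_series fps_swap_swap)
  \<comment> \<open>In variables: q(z - w) = h(w - z) q(w - z). The next identity is q(w - z) = h(z
    - w) q(z - w). They compare the scalar factors in the relations moving e and f
    respectively.\<close>
  have q: "diff_series q = fps_swap (diff_series h) * fps_swap (diff_series q)"
    by (simp add: hq swap_q' flip: fps_swap_mult diff_series_mult)
  have q': "diff_series ?q' = diff_series h * fps_swap (diff_series ?q')"
    by (simp add: hq swap_q' flip: diff_series_mult)
  \<comment> \<open>The factor q(z - w) q(w - z) between two \<psi> fields is symmetric, so \<psi>
    commutes with itself.\<close>
  have psi: "diff_series (q * ?q') = 1 * fps_swap (diff_series (q * ?q'))"
    by (simp only: diff_series_mult fps_swap_mult swap_q' fps_swap_diff_series[of q] mult_1_left mult.commute)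
  show ?thesis
    using r
  proof cases
    case ee
    then show ?thesis
      by (auto intro!: realize_exchange[where C = "fps_swap (diff_series h)"] simp: charge_def q[symmetric])
  next
    case ff
    then show ?thesis
      by (auto intro!: realize_exchange[where C = "diff_series h"] simp: charge_def q'[symmetric])
  next
    case psi_e
    then show ?thesis
      by (auto intro!: realize_exchange[where C = "fps_swap (diff_series h)"] simp: charge_def q[symmetric])
  next
    case psi_f
    then show ?thesis
      by (auto intro!: realize_exchange[where C = "diff_series h"] simp: charge_def q'[symmetric])
  next
    case (ef m n v)
    then show ?thesis
      by (simp add: realize_act act_diff act_mult act_tmode mode_e_f)
  next
    case (psi_psi m n v)
    obtain N0 where N0: "mode gen_psi m (mode gen_psi n (realize v)) = (\<Sum>k<N. \<Sum>l<N.
        cst (fps_nth (fps_nth 1 l) k) * mode gen_psi (n + int l) (mode gen_psi (m + int k) (realize v)))" if "N \<ge> N0" for N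
      using mode_exchange[of gen_psi gen_psi 1 m n "realize v"] psi by (auto simp: charge_def)
    have "mode gen_psi m (mode gen_psi n (realize v)) = (\<Sum>k<Suc N0. \<Sum>l<Suc N0.
        if l = 0 then if k = 0 then mode gen_psi n (mode gen_psi m (realize v)) else 0 else 0)"
      unfolding N0[OF le_SucI[OF order.refl]] by (intro sum.cong refl) (simp add: cst_1)
    also have "\<dots> = mode gen_psi n (mode gen_psi m (realize v))"
      by (simp add: sum.delta del: sum.lessThan_Suc)
    finally show ?thesis
      by (simp add: psi_psi realize_act act_diff act_mult act_tmode)
  qed
qed

lemma realize_rel_submodule:
  assumes h: "h = fps_compose q (- fps_X) * inverse q" and r: "r \<in> rel_submodule h"
  shows "realize r = 0"
  using r unfolding rel_submodule_def
proof (induction r rule: VT.span_induct_alt)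
  case (step c x y)
  then show ?case
    by (auto simp: realize_add realize_scale realize_act realize_relators[OF h] fock_linear_0[OF act_linear])
qed (rule realize_0)

end

section \<open>Reordering words\<close>

definition word_vec :: "(gen \<times> int) list \<Rightarrow> VT" where
  "word_vec l = vt_act (wtens l) vt_vac"

lemma vt_act_wtens: "vt_act (wtens k) (word_vec l) = word_vec (k @ l)"
  unfolding word_vec_def wtens_append vt_act_mult ..

lemma vt_act_0_left: "vt_act 0 v = 0"
  using vt_act_add_left[of 0 0 v] by simp

lemma vt_act_0_right: "vt_act x 0 = 0"
  using vt_act_add_right[of x 0 0] by simp

lemma vt_act_diff_left: "vt_act (x - y) v = vt_act x v - vt_act y v"
  using vt_act_add_left[of "x - y" y v] by simp

lemma vt_act_diff_right: "vt_act x (v - w) = vt_act x v - vt_act x w"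
  using vt_act_add_right[of x "v - w" w] by simp

lemma vt_act_sum_right: "vt_act x (sum f A) = (\<Sum>i\<in>A. vt_act x (f i))"
  by (induction A rule: infinite_finite_induct) (simp_all add: vt_act_0_right vt_act_add_right)

lemma abs_VT_conv_vt_act: "abs_VT x = vt_act x vt_vac"
  by (simp add: vt_vac_def vt_act.abs_eq)

lemma vt_act_J_vac: "y \<in> tens_J \<Longrightarrow> vt_act y vt_vac = 0"
  unfolding abs_VT_conv_vt_act[symmetric] zero_VT_def by (simp add: VT.abs_eq_iff)

lemma word_vec_span: "v \<in> VT.span (range word_vec)"
proof -
  obtain x where "v = abs_VT x"
    using Quotient_abs_rep[OF Quotient_VT, of v] by metis
  moreover have "vt_act x vt_vac \<in> VT.span (range word_vec)"
  proof (induction x rule: tens_induct)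
    case (single w c)
    have "vt_act (Poly_Mapping.single w c) vt_vac = vt_scale c (word_vec (letters w))"
      unfolding single_word[of w c] word_vec_def by (rule vt_act_tscale)
    then show ?case
      by (simp add: VT.span_scale VT.span_base)
  qed (simp_all add: vt_act_0_left VT.span_zero vt_act_add_left VT.span_add)
  ultimately show ?thesis
    by (simp add: abs_VT_conv_vt_act)
qed

abbreviation letters_deg :: "(gen \<times> int) list \<Rightarrow> int" where
  "letters_deg l \<equiv> word_deg (Word l)"

lemma letters_deg_simps [simp]:
  "letters_deg [] = 0" "letters_deg ((g, n) # l) = letters_deg l - n"
  "letters_deg (k @ l) = letters_deg k + letters_deg l"
  by (simp_all add: word_deg_def)

lemma word_vec_negative: "letters_deg l < 0 \<Longrightarrow> word_vec l = 0"
  unfolding word_vec_def by (intro vt_act_J_vac subsetD[OF tens_neg_subset_J] span_tens_neg) simp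

text \<open>For \<open>n > 0\<close> the last letter has negative degree. For \<open>n = 0\<close>
  it is minus the derivative of the letter \<open>(g, 1)\<close>, which has degree - 1. Both lie in
  the left ideal \<open>tens_J\<close>.\<close>

lemma word_vec_annihilate:
  assumes "n \<ge> 0"
  shows "word_vec (l @ [(g, n)]) = 0"
proof -
  have "wtens [(g, n)] \<in> tens_J"
  proof (cases "n = 0")
    case True
    have "wtens [(g, 1)] \<in> tens_neg"
      by (rule span_tens_neg) simp
    then have "1 * (tderiv ^^ 1) (wtens [(g, 1)]) \<in> tens_J"
      unfolding tens_J_def by (intro T.span_base) blast
    then have "tscale (- 1) (tderiv (wtens [(g, 1)])) \<in> tens_J"
      by (intro tens_J_scale) simp
    also have "tscale (- 1) (tderiv (wtens [(g, 1)])) = wtens [(g, 0)]"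
      by (simp add: tderiv_single tscale_single mult_single plus_word_def)
    finally show ?thesis using True by simp
  next
    case False
    then show ?thesis
      using assms by (intro subsetD[OF tens_neg_subset_J] span_tens_neg) simp
  qed
  then have "wtens l * wtens [(g, n)] \<in> tens_J"
    by (rule tens_J_left_ideal)
  then show ?thesis
    unfolding word_vec_def wtens_append by (rule vt_act_J_vac)
qed

text \<open>Adjacent transpositions generate all permutations; \<open>move\<close> carries one
  letter to its final place.\<close>

lemma mset_swap_invariant:
  assumes swap: "\<And>u x y v. P (u @ x # y # v) \<Longrightarrow> P (u @ y # x # v)"
    and "mset l = mset l'" and "P l"
  shows "P l'"
proof -
  have move: "P (u @ A @ x # B)" if "P (u @ x # A @ B)" for u x A B
    using that
  proof (induction A arbitrary: u)
    case (Cons a A)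
    from swap[of u x a "A @ B"] Cons.prems Cons.IH[of "u @ [a]"] show ?case by simp
  qed simp
  have "P (u @ l')" if "mset l = mset l'" "P (u @ l)" for u
    using that
  proof (induction l arbitrary: u l')
    case (Cons x t)
    then obtain A B where l': "l' = A @ x # B" and t: "mset t = mset (A @ B)"
      by (metis in_set_conv_decomp list.set_intros(1) mset_eq_setD mset.simps(2) mset_append
          add_mset_add_single union_mset_add_mset_right add_mset_remove_trivial)
    from Cons.IH[OF t, of "u @ [x]"] Cons.prems(2) have "P (u @ x # A @ B)" by simp
    then show ?case unfolding l' by (rule move)
  qed simp
  from this[of "[]"] assms show ?thesis by simp
qed

text \<open>The error terms that arise when a word of length \<open>N\<close> and degree
  \<open>d\<close> is reordered.\<close>

definition low_words :: "nat \<Rightarrow> int \<Rightarrow> VT set" where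
  "low_words N d = {word_vec l |l. length l < N \<or> length l = N \<and> letters_deg l < d}"

lemma word_vec_lower:
  assumes "length l < N \<or> length l = N \<and> letters_deg l < d"
  shows "word_vec l \<in> VT.span (low_words N d \<union> R)"
  using assms by (intro VT.span_base) (auto simp: low_words_def)

text \<open>As \<open>c 0 0 = 1\<close>, the term at \<open>(0, 0)\<close> of the infinite sum is
  the word with the two letters swapped. The other terms have the same length and degree smaller by
  \<open>i + j > 0\<close>.\<close>

lemma exchange_swap:
  assumes h: "c 0 0 = 1" and rel: "exchange c a b m n (word_vec v) \<in> rel_submodule h"
    and N: "N = length u + length v + 2" and d: "d = letters_deg u + letters_deg v - m - n"
  shows "word_vec (u @ (a, m) # (b, n) # v) - word_vec (u @ (b, n) # (a, m) # v)
    \<in> VT.span (low_words N d \<union> rel_submodule h)"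
proof -
  define f where "f = (\<lambda>(i, j). vt_scale (c i j)
    (vt_act (tmode (U_basis b) (n + int j) * tmode (U_basis a) (m + int i)) (word_vec v)))"
  have fin: "finite {s. f s \<noteq> 0}"
    using finite_exchange[of c b n a m "word_vec v"] by (simp add: f_def split_def)
  define S where "S = {s. f s \<noteq> 0} - {(0, 0)}"
  have f: "f (i, j) = vt_scale (c i j) (word_vec ((b, n + int j) # (a, m + int i) # v))" for i j
    using vt_act_wtens[of "[(b, n + int j)] @ [(a, m + int i)]" v]
    by (simp only: f_def prod.case tmode_U_basis wtens_append[symmetric]) simp
  have "Sum_any f = sum f (insert (0, 0) S)"
    by (rule Sum_any.expand_superset) (use fin in \<open>auto simp: S_def\<close>)
  also have "\<dots> = f (0, 0) + sum f S"
    using fin by (subst sum.insert) (auto simp: S_def)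
  finally have sum: "Sum_any f = word_vec ((b, n) # (a, m) # v) + sum f S"
    by (simp add: f h)
  have "exchange c a b m n (word_vec v) = word_vec ((a, m) # (b, n) # v) - Sum_any f"
    using vt_act_wtens[of "[(a, m)] @ [(b, n)]" v]
    unfolding exchange_def f_def tmode_U_basis wtens_append[symmetric] by simp
  then have "vt_act (wtens u) (exchange c a b m n (word_vec v))
      = word_vec (u @ (a, m) # (b, n) # v) - word_vec (u @ (b, n) # (a, m) # v) - (\<Sum>s\<in>S. vt_act (wtens u) (f s))"
    by (simp add: sum vt_act_diff_right vt_act_add_right vt_act_sum_right vt_act_wtens)
  then have eq: "word_vec (u @ (a, m) # (b, n) # v) - word_vec (u @ (b, n) # (a, m) # v)
      = vt_act (wtens u) (exchange c a b m n (word_vec v)) + (\<Sum>s\<in>S. vt_act (wtens u) (f s))"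
    by simp
  have "vt_act (wtens u) (f s) \<in> VT.span (low_words N d \<union> rel_submodule h)" if "s \<in> S" for s
  proof -
    obtain i j where s: "s = (i, j)" by force
    have "(i, j) \<noteq> (0, 0)" using that by (auto simp: S_def s)
    then have "word_vec (u @ (b, n + int j) # (a, m + int i) # v) \<in> VT.span (low_words N d \<union> rel_submodule h)"
      by (intro word_vec_lower) (auto simp: N d)
    then show ?thesis
      unfolding s f vt_act_vt_scale vt_act_wtens by (intro VT.span_scale) simp
  qed
  moreover have "vt_act (wtens u) (exchange c a b m n (word_vec v)) \<in> VT.span (low_words N d \<union> rel_submodule h)"
    using rel_submodule_act[OF rel] by (intro VT.span_base) simp
  ultimately show ?thesis
    unfolding eq by (intro VT.span_add VT.span_sum)
qed

lemma relators_subset: "relators h \<subseteq> rel_submodule h"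
proof
  fix r assume "r \<in> relators h"
  then have "vt_act 1 r \<in> rel_submodule h"
    unfolding rel_submodule_def by (intro VT.span_base) blast
  then show "r \<in> rel_submodule h" by simp
qed

text \<open>Each relation settles one ordered pair of generators, and \<open>sym\<close> the
  reversed pair. Modulo relations, exchange relations leave words of lower degree, e and f leave a
  shorter word, and two \<psi> leave nothing.\<close>

lemma swap_letters:
  assumes h: "fps_nth h 0 = 1"
    and N: "N = length u + length v + 2" and d: "d = letters_deg u + letters_deg v - m - n"
  shows "word_vec (u @ (a, m) # (b, n) # v) - word_vec (u @ (b, n) # (a, m) # v)
    \<in> VT.span (low_words N d \<union> rel_submodule h)"
proof -
  define P where "P = (\<lambda>a b. \<forall>m n. d = letters_deg u + letters_deg v - m - n \<longrightarrow>
    word_vec (u @ (a, m) # (b, n) # v) - word_vec (u @ (b, n) # (a, m) # v)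
    \<in> VT.span (low_words N d \<union> rel_submodule h))"
  have sym: "P b a" if "P a b" for a b
    unfolding P_def
  proof (intro allI impI)
    fix m n assume "d = letters_deg u + letters_deg v - m - n"
    then have "word_vec (u @ (a, n) # (b, m) # v) - word_vec (u @ (b, m) # (a, n) # v)
        \<in> VT.span (low_words N d \<union> rel_submodule h)"
      using that unfolding P_def by simp
    from VT.span_neg[OF this]
    show "word_vec (u @ (b, m) # (a, n) # v) - word_vec (u @ (a, n) # (b, m) # v)
        \<in> VT.span (low_words N d \<union> rel_submodule h)"
      by simp
  qed
  have c: "diff_coeff h 0 0 = 1"
    by (simp add: diff_coeff_def h)
  have short: "vt_act (wtens u) (vt_act (wtens [(a, m), (b, n)] - wtens [(b, n), (a, m)] - x) (word_vec v))
       = word_vec (u @ (a, m) # (b, n) # v) - word_vec (u @ (b, n) # (a, m) # v)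
         - vt_act (wtens u) (vt_act x (word_vec v))" for a b m n x
    by (simp add: vt_act_diff_left vt_act_diff_right vt_act_wtens)
  have pair: "tmode (U_basis a) m * tmode (U_basis b) n = wtens [(a, m), (b, n)]" for a b m n
    using wtens_append[of "[(a, m)]" "[(b, n)]"] by (simp add: tmode_U_basis)
  have span_rel: "vt_act (wtens u) r \<in> VT.span (low_words N d \<union> rel_submodule h)" if "r \<in> relators h" for r
    using rel_submodule_act[of r h] that relators_subset by (intro VT.span_base) blast
  have "P gen_e gen_e" "P gen_f gen_f" "P gen_psi gen_e" "P gen_psi gen_f"
    unfolding P_def using N
    by (intro allI impI exchange_swap; use relators_subset relators.intros c in blast)+
  moreover have "P gen_e gen_f"
    unfolding P_def
  proof (intro allI impI)
    fix m n assume d: "d = letters_deg u + letters_deg v - m - n"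
    have "word_vec (u @ (gen_psi, m + n) # v) \<in> VT.span (low_words N d \<union> rel_submodule h)"
      by (intro word_vec_lower) (simp add: N)
    from VT.span_add[OF span_rel[OF relators.ef[of m n "word_vec v"]] this]
    show "word_vec (u @ (gen_e, m) # (gen_f, n) # v) - word_vec (u @ (gen_f, n) # (gen_e, m) # v)
      \<in> VT.span (low_words N d \<union> rel_submodule h)"
      unfolding pair short by (simp add: tmode_U_basis vt_act_wtens)
  qed
  moreover have "P gen_psi gen_psi"
    unfolding P_def
  proof (intro allI impI)
    fix m n
    show "word_vec (u @ (gen_psi, m) # (gen_psi, n) # v) - word_vec (u @ (gen_psi, n) # (gen_psi, m) # v)
      \<in> VT.span (low_words N d \<union> rel_submodule h)"
      using span_rel[OF relators.psi_psi[of m n "word_vec v"]] short[of gen_psi m gen_psi n 0]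
      unfolding pair by (simp add: vt_act_0_left vt_act_0_right)
  qed
  ultimately have "P a b"
    by (cases a; cases b) (auto intro: sym)
  then show ?thesis
    using d by (simp add: P_def)
qed

section \<open>Ordered words and the spanning property\<close>

definition pbw_word :: "nat list \<times> nat list \<times> nat list \<Rightarrow> (gen \<times> int) list" where
  "pbw_word = (\<lambda>(ms, ns, ks). map (\<lambda>m. (gen_e, - int m)) ms @ map (\<lambda>m. (gen_f, - int m)) ns
     @ map (\<lambda>m. (gen_psi, - int m)) ks)"

lemma length_pbw_word: "length (pbw_word (ms, ns, ks)) = length ms + length ns + length ks"
  by (simp add: pbw_word_def)

definition pbw_span :: "complex fps \<Rightarrow> nat \<Rightarrow> VT set" where
  "pbw_span h n = VT.span (word_vec ` pbw_word ` pbw_index n \<union> rel_submodule h)"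

lemma pbw_index_mono: "m \<le> n \<Longrightarrow> pbw_index m \<subseteq> pbw_index n"
  by (auto simp: pbw_index_def)

lemma pbw_span_mono: "m \<le> n \<Longrightarrow> pbw_span h m \<subseteq> pbw_span h n"
  unfolding pbw_span_def by (intro VT.span_mono Un_mono image_mono pbw_index_mono order.refl)

lemma negative_word_pbw:
  assumes "\<And>g n. (g, n) \<in> set l \<Longrightarrow> n < 0"
  shows "\<exists>idx\<in>pbw_index (length l). mset l = mset (pbw_word idx)"
proof -
  define part where "part = (\<lambda>g. rev (sort (map (\<lambda>(g, n). nat (- n)) (filter (\<lambda>(g', n). g' = g) l))))"
  have decr: "decreasing_pos (part g)" for g
    using assms by (force simp: decreasing_pos_def part_def sorted_wrt_rev)
  have "image_mset (\<lambda>m. (g, - int m)) (mset (part g)) = image_mset (\<lambda>x. x) (filter_mset (\<lambda>(g', n). g' = g) (mset l))" for g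
    unfolding part_def mset_rev mset_sort mset_map mset_filter multiset.map_comp
  proof (rule image_mset_cong)
    fix x assume "x \<in># filter_mset (\<lambda>(g', n). g' = g) (mset l)"
    then show "((\<lambda>m. (g, - int m)) \<circ> (\<lambda>(g, n). nat (- n))) x = x"
      using assms[of "fst x" "snd x"] by (auto simp: split_def intro: prod_eqI)
  qed
  moreover have "mset l = filter_mset (\<lambda>(g', n). g' = gen_e) (mset l) + filter_mset (\<lambda>(g', n). g' = gen_f) (mset l)
      + filter_mset (\<lambda>(g', n). g' = gen_psi) (mset l)"
  proof (induction l)
    case (Cons x l)
    obtain g n where "x = (g, n)" by force
    with Cons show ?case by (cases g) auto
  qed simp
  ultimately have mset: "mset l = mset (pbw_word (part gen_e, part gen_f, part gen_psi))"
    by (simp add: pbw_word_def add.assoc)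
  then have "length l = length (part gen_e) + length (part gen_f) + length (part gen_psi)"
    by (metis size_mset length_pbw_word)
  with mset decr show ?thesis
    by (intro bexI[of _ "(part gen_e, part gen_f, part gen_psi)"]) (auto simp: pbw_index_def)
qed

lemma word_vec_pbw_span:
  assumes h: "fps_nth h 0 = 1"
  shows "word_vec l \<in> pbw_span h (length l)"
\<comment> \<open>Words of negative degree vanish, so the degree may be cut off there. The
  \<open>+ 1\<close> keeps degree 0 strictly above the negative degrees.\<close>
proof (induction l rule: wf_induct_rule[OF wf_measures[of "[length, \<lambda>l. nat (letters_deg l + 1)]"]])
  case (1 l)
  let ?S = "pbw_span h (length l)"
  show ?case
  proof (cases "letters_deg l < 0")
    case True
    then show ?thesis
      by (simp add: word_vec_negative pbw_span_def VT.span_zero)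
  next
    case nonneg: False
    have "low_words (length l) (letters_deg l) \<union> rel_submodule h \<subseteq> ?S"
    proof (intro Un_least subsetI)
      fix v assume "v \<in> low_words (length l) (letters_deg l)"
      then obtain l' where l': "v = word_vec l'" "length l' < length l \<or> length l' = length l \<and> letters_deg l' < letters_deg l"
        by (auto simp: low_words_def)
      then have "word_vec l' \<in> pbw_span h (length l')"
        using nonneg by (intro 1) auto
      then show "v \<in> ?S"
        using pbw_span_mono[of "length l'" "length l" h] l' by auto
    qed (auto simp: pbw_span_def intro: VT.span_base)
    then have low: "VT.span (low_words (length l) (letters_deg l) \<union> rel_submodule h) \<subseteq> ?S"
      unfolding pbw_span_def by (intro VT.span_minimal VT.subspace_span)
    define P where "P = (\<lambda>l'. length l' = length l \<and> letters_deg l' = letters_deg l \<and> word_vec l' \<in> ?S)"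
    have swap: "P (u @ y # x # v)" if "P (u @ x # y # v)" for u x y v
    proof -
      obtain a m b n where xy: "x = (a, m)" "y = (b, n)" by force
      have "word_vec (u @ y # x # v) - word_vec (u @ x # y # v) \<in> ?S"
        unfolding xy using that
        by (intro subsetD[OF low] swap_letters[OF h]) (auto simp: P_def xy)
      then have "word_vec (u @ y # x # v) - word_vec (u @ x # y # v) + word_vec (u @ x # y # v) \<in> ?S"
        using that unfolding P_def pbw_span_def by (intro VT.span_add) auto
      then show ?thesis
        using that by (auto simp: P_def xy)
    qed
    have deg: "letters_deg l' = letters_deg l" if "mset l' = mset l" for l'
      using that by (metis (no_types, lifting) mset_map sum_mset_sum_list word.sel word_deg_def)
    \<comment> \<open>Rearrangement preserves length and degree, so every swap on the way has the
      same space of error terms, and that space lies in \<open>?S\<close> by induction.\<close>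
    have reduce: "word_vec l \<in> ?S" if "mset l' = mset l" "word_vec l' \<in> ?S" for l'
      using mset_swap_invariant[of P l' l, OF swap] that deg[OF that(1)] mset_eq_length[OF that(1)]
      by (simp add: P_def)
    show ?thesis
    proof (cases "\<exists>g n. (g, n) \<in> set l \<and> n \<ge> 0")
      case True
      then obtain g n A B where "n \<ge> 0" "l = A @ (g, n) # B"
        by (metis in_set_conv_decomp)
      then show ?thesis
        by (intro reduce[of "(A @ B) @ [(g, n)]"])
          (simp_all add: word_vec_annihilate pbw_span_def VT.span_zero del: append_assoc)
    next
      case False
      then obtain idx where "idx \<in> pbw_index (length l)" "mset l = mset (pbw_word idx)"
        using negative_word_pbw[of l] by (metis not_le)
      then show ?thesis
        by (intro reduce[of "pbw_word idx"]) (auto simp: pbw_span_def intro: VT.span_base)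
    qed
  qed
qed

section \<open>The basis\<close>

context normalized_twisted_fock
begin

definition lead_mset :: "(gen \<times> int) list \<Rightarrow> fvar multiset" where
  "lead_mset l = (\<Sum>(g, n)\<leftarrow>l. lead_factor g (nat (- n)))"

lemma lead_mset_simps [simp]:
  "lead_mset [] = {#}" "lead_mset ((g, n) # l) = lead_factor g (nat (- n)) + lead_mset l"
  "lead_mset (k @ l) = lead_mset k + lead_mset l"
  by (simp_all add: lead_mset_def)

lemma leads_word:
  assumes "\<And>g n. (g, n) \<in> set l \<Longrightarrow> n < 0"
  shows "leads (lead_mset l) (word_op l fock_vac)"
  using assms
proof (induction l)
  case Nil
  show ?case by (simp add: leads_def)
next
  case (Cons x l)
  obtain g n where x: "x = (g, n)" by force
  then have "n < 0" using Cons.prems[of g n] by simp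
  then have "leads (lead_factor g (nat (- n)) + lead_mset l) (mode g (- int (nat (- n))) (word_op l fock_vac))"
    using Cons by (intro leads_mode) auto
  then show ?case
    using \<open>n < 0\<close> by (simp add: x)
qed

lemma realize_word: "realize (word_vec l) = word_op l fock_vac"
  by (simp add: word_vec_def realize_act realize_vac act_single cst_1)

text \<open>On positive entries \<open>m\<close> \<mapsto> \<open>m - 1\<close> can be inverted, and
  a decreasing list is determined by its multiset.\<close>

lemma decreasing_pos_unique:
  assumes "decreasing_pos ms" "decreasing_pos ms'"
    and eq: "image_mset (\<lambda>m. (K, m - 1)) (mset ms) = image_mset (\<lambda>m. (K, m - 1)) (mset ms')"
  shows "ms = ms'"
proof -
  have "image_mset (\<lambda>x. Suc (snd x)) (image_mset (\<lambda>m. (K, m - 1)) (mset ms)) = mset ms"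
    if "decreasing_pos ms" for ms
  proof -
    have "image_mset (\<lambda>m. Suc (m - 1)) (mset ms) = image_mset (\<lambda>m. m) (mset ms)"
      using that by (intro image_mset_cong) (force simp: decreasing_pos_def)
    then show ?thesis
      by (simp add: multiset.map_comp comp_def)
  qed
  then have "mset ms = mset ms'"
    using assms by metis
  moreover have "sorted (rev ms)" "sorted (rev ms')"
    using assms by (simp_all add: decreasing_pos_def sorted_wrt_rev)
  ultimately have "rev ms = rev ms'"
    by (metis mset_rev properties_for_sort)
  then show ?thesis by simp
qed

text \<open>The x and y variables recover \<open>ms\<close> and \<open>ns\<close>. The c variables
  recover \<open>ks\<close> after removal of the \<open>length ns\<close> copies of c_0 that stem
  from the f modes, a number known once \<open>ns\<close> is.\<close>

lemma inj_on_lead_mset: "inj_on (\<lambda>idx. lead_mset (pbw_word idx)) (pbw_index n)"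
proof (rule inj_onI, unfold split_paired_all)
  fix ms ns ks ms' ns' ks'
  assume decr: "(ms, ns, ks) \<in> pbw_index n" "(ms', ns', ks') \<in> pbw_index n"
    and eq: "lead_mset (pbw_word (ms, ns, ks)) = lead_mset (pbw_word (ms', ns', ks'))"
  have parts: "lead_mset (map (\<lambda>m. (gen_e, - int m)) l)
        = replicate_mset (length l) (Fb, 0) + image_mset (\<lambda>m. (Fx, m - 1)) (mset l)"
      "lead_mset (map (\<lambda>m. (gen_f, - int m)) l)
        = replicate_mset (length l) (Fc, 0) + image_mset (\<lambda>m. (Fy, m - 1)) (mset l)"
      "lead_mset (map (\<lambda>m. (gen_psi, - int m)) l)
        = replicate_mset (length l) (Fb, 0) + image_mset (\<lambda>m. (Fc, m - 1)) (mset l)" for l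
    by (induction l) (simp_all add: add_mset_commute)
  have filter_image: "filter_mset (\<lambda>v. fst v = K) (image_mset (\<lambda>m. (K', m - 1)) M)
    = (if K = K' then image_mset (\<lambda>m. (K', m - 1)) M else {#})" for K K' and M :: "nat multiset"
    by (induction M) auto
  have filter_replicate: "filter_mset (\<lambda>v. fst v = K) (replicate_mset k (K', 0 :: nat))
    = (if K = K' then replicate_mset k (K', 0) else {#})" for K K' k
    by (induction k) auto
  have lead: "lead_mset (pbw_word (ms, ns, ks)) = replicate_mset (length ms) (Fb, 0) + image_mset (\<lambda>m. (Fx, m - 1)) (mset ms)
     + (replicate_mset (length ns) (Fc, 0) + image_mset (\<lambda>m. (Fy, m - 1)) (mset ns))
     + (replicate_mset (length ks) (Fb, 0) + image_mset (\<lambda>m. (Fc, m - 1)) (mset ks))" for ms ns ks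
    by (simp add: pbw_word_def parts)
  have "filter_mset (\<lambda>v. fst v = K) (lead_mset (pbw_word (ms, ns, ks)))
      = filter_mset (\<lambda>v. fst v = K) (lead_mset (pbw_word (ms', ns', ks')))" for K
    using eq by simp
  from this[of Fx] this[of Fy] this[of Fc]
  have "image_mset (\<lambda>m. (Fx, m - 1)) (mset ms) = image_mset (\<lambda>m. (Fx, m - 1)) (mset ms')"
    and ns: "image_mset (\<lambda>m. (Fy, m - 1)) (mset ns) = image_mset (\<lambda>m. (Fy, m - 1)) (mset ns')"
    and ks: "replicate_mset (length ns) (Fc, 0) + image_mset (\<lambda>m. (Fc, m - 1)) (mset ks)
      = replicate_mset (length ns') (Fc, 0) + image_mset (\<lambda>m. (Fc, m - 1)) (mset ks')"
    by (simp_all add: lead filter_image filter_replicate del: One_nat_def)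
  then have "ms = ms'" and ns: "ns = ns'"
    using decr by (auto simp: pbw_index_def intro: decreasing_pos_unique)
  moreover have "ks = ks'"
    using decr ks by (auto simp: pbw_index_def ns intro: decreasing_pos_unique)
  ultimately show "(ms, ns, ks) = (ms', ns', ks')"
    using ns by simp
qed

section \<open>Linear independence by leading monomials\<close>

lemma lookup_cst_mult: "Poly_Mapping.lookup (cst c * p) M = c * Poly_Mapping.lookup p M"
  by (simp add: mult_map_scale_conv_mult[symmetric] Poly_Mapping.map.rep_eq when_def)

text \<open>Among the indices with nonzero coefficient, \<open>j\<close> has maximal weight. The
  monomial \<open>\<mu> j\<close> then occurs in no other contributing term: the other leading
  monomials differ from it, and all remaining monomials have smaller weight.\<close>

lemma leads_independent:
  assumes fin: "finite A" and inj: "inj_on \<mu> A" and leads: "\<And>i. i \<in> A \<Longrightarrow> leads (\<mu> i) (f i)"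
    and sum: "(\<Sum>i\<in>A. cst (c i) * f i) = 0" and i: "i \<in> A"
  shows "c i = 0"
proof (rule ccontr)
  assume "c i \<noteq> 0"
  let ?w = "\<lambda>k. weight lead_var (\<mu> k)"
  define B where "B = {i \<in> A. c i \<noteq> 0}"
  have B: "finite B" "B \<noteq> {}"
    using fin i \<open>c i \<noteq> 0\<close> by (auto simp: B_def)
  from obtains_MAX[OF B] obtain j where j: "j \<in> B" "?w j = Max (?w ` B)"
    by metis
  have "c k * Poly_Mapping.lookup (f k) (\<mu> j) = (if k = j then c j else 0)" if k: "k \<in> A" for k
  proof (cases "c k = 0")
    case False
    then have "?w k \<le> ?w j"
      using k B j by (simp add: B_def)
    moreover have "f k - pmon (\<mu> k) \<in> filt lead_var (?w k - 1)"
      using leads[OF k] by (simp add: leads_def)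
    ultimately have "\<mu> j \<notin> Poly_Mapping.keys (f k - pmon (\<mu> k))"
      unfolding filt_def by (metis (no_types, lifting) mem_Collect_eq not_le zle_diff1_eq)
    then have "Poly_Mapping.lookup (f k - pmon (\<mu> k)) (\<mu> j) = 0"
      by (simp add: not_in_keys_iff_lookup_eq_zero)
    moreover have "\<mu> k = \<mu> j \<longleftrightarrow> k = j"
      using inj k j by (auto simp: B_def inj_on_def)
    ultimately show ?thesis
      by (simp add: lookup_minus lookup_single when_def split: if_splits)
  qed (use j in \<open>auto simp: B_def\<close>)
  then have "(\<Sum>k\<in>A. c k * Poly_Mapping.lookup (f k) (\<mu> j)) = (\<Sum>k\<in>A. if k = j then c j else 0)"
    by (rule sum.cong[OF refl])
  also have "\<dots> = c j"
    using fin j by (simp add: B_def)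
  also have "(\<Sum>k\<in>A. c k * Poly_Mapping.lookup (f k) (\<mu> j)) = Poly_Mapping.lookup (\<Sum>k\<in>A. cst (c k) * f k) (\<mu> j)"
    by (simp add: lookup_sum lookup_cst_mult)
  finally show False
    using j by (simp add: sum B_def)
qed

text \<open>\<open>realize\<close> kills the relations, so a dependence modulo relations becomes one
  between polynomials with distinct leading monomials.\<close>

lemma pbw_independent:
  assumes h: "h = fps_compose q (- fps_X) * inverse q"
    and I: "finite I" "I \<subseteq> pbw_index n"
    and rel: "(\<Sum>i\<in>I. vt_scale (c i) (word_vec (pbw_word i))) \<in> rel_submodule h" and i: "i \<in> I"
  shows "c i = 0"
proof (rule leads_independent[OF I(1) _ _ _ i])
  show "inj_on (\<lambda>idx. lead_mset (pbw_word idx)) I"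
    using inj_on_lead_mset I(2) by (rule inj_on_subset)
  show "leads (lead_mset (pbw_word i)) (word_op (pbw_word i) fock_vac)" if "i \<in> I" for i
    using subsetD[OF I(2) that]
    by (intro leads_word) (fastforce simp: pbw_word_def pbw_index_def decreasing_pos_def)
  show "(\<Sum>i\<in>I. cst (c i) * word_op (pbw_word i) fock_vac) = 0"
    using realize_rel_submodule[OF h rel] by (simp add: realize_sum realize_scale realize_word)
qed

end

section \<open>Passage to the quotient by the relations\<close>

lemma va_mode_word_vec: "va_mode h (U_basis g) n (va_class h (word_vec l)) = va_class h (word_vec ((g, n) # l))"
  using vt_act_wtens[of "[(g, n)]" l] by (simp add: va_mode_def va_act_class tmode_U_basis)

lemma foldr_va_mode_word_vec:
  "foldr (\<lambda>m. va_mode h (U_basis g) (- int m)) ms (va_class h (word_vec l))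
     = va_class h (word_vec (map (\<lambda>m. (g, - int m)) ms @ l))"
  by (induction ms) (simp_all add: va_mode_word_vec)

lemma va_vac_word_vec: "va_vac h = va_class h (word_vec [])"
  by (simp add: va_vac_def word_vec_def wtens_Nil)

lemma pbw_vector_word_vec: "pbw_vector h idx = va_class h (word_vec (pbw_word idx))"
  by (cases idx) (simp add: pbw_vector_def pbw_word_def va_vac_word_vec foldr_va_mode_word_vec)

abbreviation words_upto :: "nat \<Rightarrow> VT set" where
  "words_upto n \<equiv> VT.span (word_vec ` {l. length l \<le> n})"

lemma pbw_span_eq:
  assumes "fps_nth h 0 = 1"
  shows "pbw_span h n = VT.span (words_upto n \<union> rel_submodule h)"
proof
  have "word_vec ` {l. length l \<le> n} \<subseteq> pbw_span h n"
    using word_vec_pbw_span[OF assms] pbw_span_mono by blast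
  moreover have "rel_submodule h \<subseteq> pbw_span h n"
    unfolding pbw_span_def by (intro subsetI VT.span_base) simp
  ultimately show "VT.span (words_upto n \<union> rel_submodule h) \<subseteq> pbw_span h n"
    unfolding pbw_span_def by (intro VT.span_minimal Un_least VT.subspace_span)
  have "pbw_word ` pbw_index n \<subseteq> {l. length l \<le> n}"
    by (auto simp: pbw_index_def length_pbw_word)
  then show "pbw_span h n \<subseteq> VT.span (words_upto n \<union> rel_submodule h)"
    unfolding pbw_span_def by (intro VT.span_mono Un_mono order.refl) (auto intro: VT.span_base)
qed

text \<open>\<open>r\<close> chooses a representative of each coset, so that linear combinations of
  cosets can be computed in \<open>VT\<close>.\<close>

lemma VA_lincomb:
  assumes "finite A" "\<And>X. X \<in> A \<Longrightarrow> va_class h (r X) = X"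
  shows "LinearCombinations.module.lincomb (VA h) a A = va_class h (\<Sum>X\<in>A. vt_scale (a X) (r X))"
proof -
  interpret V: vectorspace class_ring "VA h"
    by (rule VA_vectorspace)
  show ?thesis
    using assms
  proof (induction A)
    case empty
    then show ?case by (simp add: VA_zero)
  next
    case (insert X A)
    have carrier: "X' \<in> carrier (VA h)" if "X' \<in> insert X A" for X'
      using insert.prems[OF that] by (auto simp: VA_carrier)
    have "V.lincomb a (insert X A) = (a X \<odot>\<^bsub>VA h\<^esub> X) \<oplus>\<^bsub>VA h\<^esub> V.lincomb a A"
      using insert.hyps carrier by (intro V.lincomb_insert2) auto
    also have "a X \<odot>\<^bsub>VA h\<^esub> X = va_class h (vt_scale (a X) (r X))"
      using VA_smult[where c = "a X" and v = "r X" and h = h] insert.prems by simp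
    finally show ?case
      using insert by (simp add: VA_add)
  qed
qed

lemma VA_span: "LinearCombinations.module.span class_ring (VA h) (va_class h ` B) = va_class h ` VT.span B"
proof -
  interpret V: vectorspace class_ring "VA h"
    by (rule VA_vectorspace)
  have B: "va_class h ` B \<subseteq> carrier (VA h)"
    by (auto simp: VA_carrier)
  show ?thesis
  proof (intro equalityI subsetI)
    fix X assume "X \<in> V.span (va_class h ` B)"
    then obtain a A where X: "X = V.lincomb a A" and A: "finite A" "A \<subseteq> va_class h ` B"
      unfolding V.span_def by auto
    define r where "r = inv_into B (va_class h)"
    have r: "va_class h (r Y) = Y" "r Y \<in> B" if "Y \<in> A" for Y
      using that A(2) by (auto simp: r_def intro!: f_inv_into_f inv_into_into)
    have "X = va_class h (\<Sum>Y\<in>A. vt_scale (a Y) (r Y))"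
      unfolding X by (rule VA_lincomb[OF A(1) r(1)])
    moreover have "(\<Sum>Y\<in>A. vt_scale (a Y) (r Y)) \<in> VT.span B"
      using r(2) by (intro VT.span_sum VT.span_scale VT.span_base)
    ultimately show "X \<in> va_class h ` VT.span B" by blast
  next
    fix X assume "X \<in> va_class h ` VT.span B"
    then obtain v where v: "X = va_class h v" "v \<in> VT.span B" by blast
    have sub: "submodule class_ring (V.span (va_class h ` B)) (VA h)"
      by (rule V.span_is_submodule[OF B])
    have "va_class h v \<in> V.span (va_class h ` B)"
      using v(2)
    proof (induction v rule: VT.span_induct_alt)
      case base
      then show ?case using V.span_zero by (simp add: VA_zero)
    next
      case (step c x y)
      have "va_class h x \<in> V.span (va_class h ` B)"
        using V.in_own_span[OF B] step by blast
      then have "c \<odot>\<^bsub>VA h\<^esub> va_class h x \<oplus>\<^bsub>VA h\<^esub> va_class h y \<in> V.span (va_class h ` B)"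
        using sub step unfolding submodule_def by auto
      then show ?case by (simp add: VA_smult VA_add)
    qed
    then show "X \<in> V.span (va_class h ` B)" by (simp add: v)
  qed
qed

lemma va_class_image_rel:
  "va_class h ` VT.span (B \<union> rel_submodule h) = va_class h ` VT.span B"
proof (intro equalityI image_subsetI)
  fix v assume "v \<in> VT.span (B \<union> rel_submodule h)"
  then obtain x y where v: "v = x + y" "x \<in> VT.span B" "y \<in> VT.span (rel_submodule h)"
    unfolding VT.span_Un by blast
  then have "y \<in> rel_submodule h"
    unfolding rel_submodule_def by (simp add: VT.span_span)
  then have "va_class h v = va_class h x"
    by (simp add: va_class_eq_iff v)
  then show "va_class h v \<in> va_class h ` VT.span B"
    using v by blast
next
  fix v assume "v \<in> VT.span B"
  then have "v \<in> VT.span (B \<union> rel_submodule h)"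
    by (rule subsetD[OF VT.span_mono, rotated]) simp
  then show "va_class h v \<in> va_class h ` VT.span (B \<union> rel_submodule h)"
    by (rule imageI)
qed

text \<open>Every element of U is a combination of the three generators, so a product of modes
  expands into words with the same number of letters.\<close>

lemma foldr_va_mode:
  "\<exists>v \<in> VT.span (word_vec ` {l. length l = length us}).
     foldr (\<lambda>(u, m). va_mode h u m) us (va_vac h) = va_class h v"
proof (induction us)
  case Nil
  then show ?case
    by (intro bexI[of _ "word_vec []"]) (auto simp: va_vac_word_vec intro: VT.span_base)
next
  case (Cons um us)
  obtain u m where um: "um = (u, m)" by force
  obtain v where v: "v \<in> VT.span (word_vec ` {l. length l = length us})"
    "foldr (\<lambda>(u, m). va_mode h u m) us (va_vac h) = va_class h v"
    using Cons by blast
  have "vt_act (tmode u m) v \<in> VT.span (word_vec ` {l. length l = Suc (length us)})"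
    using v(1)
  proof (induction v rule: VT.span_induct_alt)
    case base
    then show ?case by (simp add: vt_act_0_right VT.span_zero)
  next
    case (step c x y)
    then obtain l where l: "x = word_vec l" "length l = length us" by auto
    have "vt_act (Poly_Mapping.single (Word [(g, m)]) k) x \<in> VT.span (word_vec ` {l. length l = Suc (length us)})" for g k
      unfolding single_word[of _ k] vt_act_tscale l word.sel vt_act_wtens
      by (intro VT.span_scale VT.span_base) (simp add: l)
    then have "vt_act (tmode u m) x \<in> VT.span (word_vec ` {l. length l = Suc (length us)})"
      unfolding tmode_def by (simp add: vt_act_add_left VT.span_add)
    then show ?case
      by (simp add: vt_act_add_right vt_act_vt_scale VT.span_add VT.span_scale step)
  qed
  moreover have "va_mode h u m (va_class h v) = va_class h (vt_act (tmode u m) v)"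
    by (simp add: va_mode_def va_act_class)
  ultimately show ?case
    by (intro bexI[of _ "vt_act (tmode u m) v"]) (simp_all add: um v)
qed

lemma E_filt_words: "E_filt h n = va_class h ` words_upto n"
proof -
  interpret V: vectorspace class_ring "VA h"
    by (rule VA_vectorspace)
  let ?G = "{foldr (\<lambda>(u, m). va_mode h u m) us (va_vac h) |us. length us \<le> n}"
  have "va_class h ` word_vec ` {l. length l \<le> n} \<subseteq> ?G"
  proof clarify
    fix l :: "(gen \<times> int) list" assume l: "length l \<le> n"
    have "foldr (\<lambda>(u, m). va_mode h u m) (map (\<lambda>(g, m). (U_basis g, m)) l) (va_vac h) = va_class h (word_vec l)"
      by (induction l) (auto simp: va_vac_word_vec va_mode_word_vec)
    then show "\<exists>us. va_class h (word_vec l) = foldr (\<lambda>(u, m). va_mode h u m) us (va_vac h) \<and> length us \<le> n"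
      using l by (metis length_map)
  qed
  then have "va_class h ` words_upto n \<subseteq> E_filt h n"
    unfolding E_filt_def VA_span[symmetric] by (rule V.span_is_monotone)
  moreover have "?G \<subseteq> V.span (va_class h ` word_vec ` {l. length l \<le> n})"
  proof clarify
    fix us :: "(U \<times> int) list" assume "length us \<le> n"
    then have "VT.span (word_vec ` {l. length l = length us}) \<subseteq> words_upto n"
      by (intro VT.span_mono) auto
    then show "foldr (\<lambda>(u, m). va_mode h u m) us (va_vac h) \<in> V.span (va_class h ` word_vec ` {l. length l \<le> n})"
      unfolding VA_span using foldr_va_mode[of us h] by auto
  qed
  then have "E_filt h n \<subseteq> V.span (va_class h ` word_vec ` {l. length l \<le> n})"
    unfolding E_filt_def by (intro V.span_is_subset V.span_is_submodule) (auto simp: VA_carrier)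
  ultimately show ?thesis
    by (auto simp: VA_span)
qed

lemma E_filt_pbw:
  assumes "fps_nth h 0 = 1"
  shows "E_filt h n = LinearCombinations.module.span class_ring (VA h) (pbw_vector h ` pbw_index n)"
proof -
  have "E_filt h n = va_class h ` pbw_span h n"
    by (simp add: E_filt_words pbw_span_eq[OF assms] va_class_image_rel VT.span_span)
  also have "\<dots> = va_class h ` VT.span (word_vec ` pbw_word ` pbw_index n)"
    by (simp add: pbw_span_def va_class_image_rel)
  also have "\<dots> = LinearCombinations.module.span class_ring (VA h) (pbw_vector h ` pbw_index n)"
    by (simp add: VA_span[symmetric] image_image pbw_vector_word_vec)
  finally show ?thesis .
qed

lemma inj_on_pbw_vector:
  assumes q: "fps_nth q 0 = 1" and h: "h = fps_compose q (- fps_X) * inverse q"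
  shows "inj_on (pbw_vector h) (pbw_index n)"
proof (rule inj_onI, rule ccontr)
  interpret normalized_twisted_fock q
    by standard (rule q)
  fix i j assume ij: "i \<in> pbw_index n" "j \<in> pbw_index n" "pbw_vector h i = pbw_vector h j" "i \<noteq> j"
  \<comment> \<open>A coincidence of two vectors is a linear dependence with coefficients 1 and -
    1.\<close>
  then have "(\<Sum>k\<in>{i, j}. vt_scale (if k = i then 1 else - 1) (word_vec (pbw_word k))) \<in> rel_submodule h"
    by (simp add: pbw_vector_word_vec va_class_eq_iff)
  from pbw_independent[OF h _ _ this, of n i] ij show False
    by simp
qed

lemma lin_indpt_pbw_vector:
  assumes q: "fps_nth q 0 = 1" and h: "h = fps_compose q (- fps_X) * inverse q"
  shows "\<not> LinearCombinations.module.lin_dep class_ring (VA h) (pbw_vector h ` pbw_index n)"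
proof
  interpret normalized_twisted_fock q
    by standard (rule q)
  interpret V: vectorspace class_ring "VA h"
    by (rule VA_vectorspace)
  assume "V.lin_dep (pbw_vector h ` pbw_index n)"
  then obtain A a X where A: "finite A" "A \<subseteq> pbw_vector h ` pbw_index n" and zero: "V.lincomb a A = \<zero>\<^bsub>VA h\<^esub>"
    and X: "X \<in> A" "a X \<noteq> 0"
    unfolding V.lin_dep_def by auto
  obtain I where I: "I \<subseteq> pbw_index n" "finite I" "A = pbw_vector h ` I"
    using finite_subset_image[OF A] by blast
  \<comment> \<open>Injectivity turns a combination over vectors into one over indices, to which
    \<open>pbw_independent\<close> applies.\<close>
  have inj: "inj_on (pbw_vector h) I"
    using inj_on_pbw_vector[OF q h] I(1) by (rule inj_on_subset)
  define r where "r = (\<lambda>X. word_vec (pbw_word (inv_into I (pbw_vector h) X)))"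
  have "V.lincomb a A = va_class h (\<Sum>X\<in>A. vt_scale (a X) (r X))"
    by (rule VA_lincomb[OF A(1)])
      (auto simp: r_def I(3) inv_into_f_f[OF inj] simp flip: pbw_vector_word_vec)
  also have "(\<Sum>X\<in>A. vt_scale (a X) (r X)) = (\<Sum>i\<in>I. vt_scale (a (pbw_vector h i)) (word_vec (pbw_word i)))"
    unfolding I(3) sum.reindex[OF inj] by (intro sum.cong refl) (simp add: r_def inv_into_f_f[OF inj])
  finally have "(\<Sum>i\<in>I. vt_scale (a (pbw_vector h i)) (word_vec (pbw_word i))) \<in> rel_submodule h"
    by (simp add: zero VA_zero va_class_eq_iff)
      (metis rel_submodule_0 rel_submodule_diff diff_0 minus_minus)
  from pbw_independent[OF h I(2,1) this] X show False
    by (auto simp: I(3))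
qed

theorem corollary4p5:
  fixes q h :: "complex fps"
  assumes "fps_nth q 0 = 1"
    and "h = fps_compose q (- fps_X) * inverse q"
  shows "((\<forall>n. VectorSpace.subspace class_ring (E_filt h n) (VA h)) \<and>
          (\<forall>n. E_filt h n \<subseteq> E_filt h (Suc n)) \<and>
          (\<Union>n. E_filt h n) = carrier (VA h)) \<and>
         (\<forall>n. inj_on (pbw_vector h) (pbw_index n) \<and>
              vectorspace.basis class_ring ((VA h)\<lparr>carrier := E_filt h n\<rparr>)
                (pbw_vector h ` pbw_index n))"
proof (intro conjI allI)
  interpret V: vectorspace class_ring "VA h"
    by (rule VA_vectorspace)
  have h0: "fps_nth h 0 = 1"
    using assms by (simp add: fps_compose_uminus')
  have carrier: "pbw_vector h ` pbw_index n \<subseteq> carrier (VA h)" for n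
    by (auto simp: VA_carrier pbw_vector_word_vec)
  show subspace: "VectorSpace.subspace class_ring (E_filt h n) (VA h)" for n
    unfolding E_filt_pbw[OF h0] by (rule V.span_is_subspace[OF carrier])
  show "E_filt h n \<subseteq> E_filt h (Suc n)" for n
    unfolding E_filt_words by (intro image_mono VT.span_mono) auto
  show "(\<Union>n. E_filt h n) = carrier (VA h)"
  proof -
    have "v \<in> (\<Union>n. words_upto n)" for v
      using word_vec_span[of v]
    proof (induction v rule: VT.span_induct_alt)
      case base
      then show ?case by (auto intro: VT.span_zero)
    next
      case (step c x y)
      then obtain l n where l: "x = word_vec l" and y: "y \<in> words_upto n" by auto
      define N where "N = max n (length l)"
      have "y \<in> words_upto N"
        using y by (rule subsetD[OF VT.span_mono, rotated]) (auto simp: N_def)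
      moreover have "x \<in> words_upto N"
        by (auto simp: l N_def intro: VT.span_base)
      ultimately have "vt_scale c x + y \<in> words_upto N"
        by (intro VT.span_add VT.span_scale)
      then show ?case by blast
    qed
    then have "UNIV = (\<Union>n. words_upto n)"
      by (rule UNIV_eq_I)
    then show ?thesis
      unfolding E_filt_words VA_carrier image_UN[symmetric] by (rule arg_cong[OF sym])
  qed
  show "inj_on (pbw_vector h) (pbw_index n)" for n
    by (rule inj_on_pbw_vector[OF assms])
  show "vectorspace.basis class_ring ((VA h)\<lparr>carrier := E_filt h n\<rparr>) (pbw_vector h ` pbw_index n)" for n
  proof -
    have sub: "submodule class_ring (E_filt h n) (VA h)"
      using subspace[of n] by (simp add: VectorSpace.subspace_def)
    interpret E: vectorspace class_ring "(VA h)\<lparr>carrier := E_filt h n\<rparr>"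
      by (rule V.subspace_is_vs[OF subspace])
    have subset: "pbw_vector h ` pbw_index n \<subseteq> E_filt h n"
      unfolding E_filt_pbw[OF h0] by (rule V.in_own_span[OF carrier])
    show ?thesis
      \<comment> \<open>Span and linear dependence inside the subspace agree with those in the
        ambient space, where both are already known.\<close>
      unfolding E.basis_def V.span_li_not_depend[OF subset sub]
      using lin_indpt_pbw_vector[OF assms] subset by (simp add: E_filt_pbw[OF h0])
  qed
qed

end
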